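(* Suppose $s>1$. Let $Z$ be a nonzero (i.e. not identically zero) west-facing zonal flow on $M_s$ whose support is contained in $M_s\setminus\{(0,0,\pm1)\}$, and let $a\in\mathbb R$, $a>0$. Then there exists $Y\in\mathfrak g$ such that $$MC^{\mathfrak g\oplus\mathbb R}_{(Z,a),(Y,b)}>0\quad\text{for every } b\in\mathbb R.$$
   Context: For $s\ge1$, $M_s:=\{(x,y,z)\in\mathbb R^3: x^2+y^2=s^2(1-z^2)\}$, with the Riemannian metric $g$ induced from $\mathbb R^3$ and the Riemannian volume form $\mu$, oriented so that in coordinates (longitude $\theta$, arc length $r$ along meridians increasing with $z$) $\mu$ is a positive multiple of $d\theta\wedge dr$ (the outward orientation). $\mathfrak g$ is the space of smooth divergence-free vector fields on $M_s$, with the usual commutator bracket $[X,Y]$ of vector fields and inner product $\langle X,Y\rangle=\int_{M_s} g(X,Y)\,\mu$. Let $\eta:=z\mu$ and $\Omega(X,Y):=\int_{M_s}\eta(X,Y)\,\mu$, i.e. $\Omega(X,Y)=\int_{M_s} z\,\mu(X,Y)\,\mu$, a 2-cocycle on $\mathfrak g$. The space $\mathfrak g\oplus\mathbb R$ carries the Lie bracket $[(X,a),(Y,b)]=([X,Y],\Omega(X,Y))$ and the inner product $\langle (X,a),(Y,b)\rangle=\langle X,Y\rangle+ab$. It is the Lie algebra of a central extension of the identity component of the group of volume-preserving diffeomorphisms of $M_s$. For a Lie algebra $\mathfrak h$ with inner product $\langle\,,\rangle$ and norm $\|\cdot\|$, the Misiołek curvature of $X,Y\in\mathfrak h$ is $MC^{\mathfrak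 h}_{X,Y}:=-\|[X,Y]\|^2-\langle X,[[X,Y],Y]\rangle$. It is used here with $\mathfrak h=\mathfrak g\oplus\mathbb R$. A zonal flow on $M_s$ is a smooth vector field of the form $Z=F(z)(x\partial_y-y\partial_x)$ for some function $F$; it is called west-facing if $F\le 0$. *)

theory Defs
  imports "HOL-Analysis.Analysis"
begin

section \<open>Smooth vector fields on the ellipsoid of revolution\<close>

definition ellipsoid :: "real \<Rightarrow> (real^3) set" where
  "ellipsoid s = {p. (p$1)\<^sup>2 + (p$2)\<^sup>2 = s\<^sup>2 * (1 - (p$3)\<^sup>2)}"

text \<open>Half the gradient of the defining function \<open>x\<^sup>2 + y\<^sup>2 + s\<^sup>2 z\<^sup>2 - s\<^sup>2\<close>; it is nonzero on the
  surface and points outwards.\<close>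

definition conormal :: "real \<Rightarrow> real^3 \<Rightarrow> real^3" where
  "conormal s p = vector [p$1, p$2, s\<^sup>2 * p$3]"

definition tangent_plane :: "real \<Rightarrow> real^3 \<Rightarrow> (real^3) set" where
  "tangent_plane s p = {v. v \<bullet> conormal s p = 0}"

text \<open>\<open>ck_on k U f\<close> is meant for open \<open>U\<close> and says that \<open>f\<close> is of class \<open>C\<^sup>k\<close> on \<open>U\<close>.\<close>

primrec ck_on ::
  "nat \<Rightarrow> 'a::euclidean_space set \<Rightarrow> ('a \<Rightarrow> 'b::real_normed_vector) \<Rightarrow> bool" where
  "ck_on 0 U f \<longleftrightarrow> continuous_on U f"
| "ck_on (Suc k) U f \<longleftrightarrow>
     (\<forall>p\<in>U. f differentiable (at p)) \<and>
     (\<forall>v. ck_on k U (\<lambda>p. frechet_derivative f (at p) v))"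

definition smooth_on :: "'a::euclidean_space set \<Rightarrow> ('a \<Rightarrow> 'b::real_normed_vector) \<Rightarrow> bool" where
  "smooth_on U f \<longleftrightarrow> (\<forall>k. ck_on k U f)"

text \<open>A vector field on the surface is a function on the ambient space of which only the values on
  the surface matter: every notion below depends on those values only.  Smoothness is that of
  maps on an embedded submanifold, i.e. existence of a smooth extension to a neighbourhood.\<close>

definition smooth_vector_field :: "real \<Rightarrow> (real^3 \<Rightarrow> real^3) \<Rightarrow> bool" where
  "smooth_vector_field s X \<longleftrightarrow>
     (\<forall>p\<in>ellipsoid s. X p \<in> tangent_plane s p) \<and>
     (\<exists>U X'. open U \<and> ellipsoid s \<subseteq> U \<and> smooth_on U X' \<and> (\<forall>p\<in>ellipsoid s. X' p = X p))"

text \<open>Derivative along the surface.  A derivative of \<open>X\<close> at \<open>p\<close> within the surface is unique only on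
  tangent vectors, so \<open>surface_deriv s X p v\<close> is used for tangent \<open>v\<close> only; there it is the
  directional derivative of any smooth extension of \<open>X\<close>.\<close>

definition surface_deriv :: "real \<Rightarrow> (real^3 \<Rightarrow> real^3) \<Rightarrow> real^3 \<Rightarrow> real^3 \<Rightarrow> real^3" where
  "surface_deriv s X p v = frechet_derivative X (at p within ellipsoid s) v"

definition vf_bracket ::
  "real \<Rightarrow> (real^3 \<Rightarrow> real^3) \<Rightarrow> (real^3 \<Rightarrow> real^3) \<Rightarrow> real^3 \<Rightarrow> real^3" where
  "vf_bracket s X Y p = surface_deriv s Y p (X p) - surface_deriv s X p (Y p)"

text \<open>The divergence is the trace of the covariant derivative.  The covariant derivative of the
  induced metric is the tangential part of the surface derivative, so its inner product with a
  tangent vector is that of the surface derivative itself.\<close>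

definition divergence_free :: "real \<Rightarrow> (real^3 \<Rightarrow> real^3) \<Rightarrow> bool" where
  "divergence_free s X \<longleftrightarrow>
     (\<forall>p\<in>ellipsoid s. \<forall>e\<^sub>1\<in>tangent_plane s p. \<forall>e\<^sub>2\<in>tangent_plane s p.
        norm e\<^sub>1 = 1 \<and> norm e\<^sub>2 = 1 \<and> e\<^sub>1 \<bullet> e\<^sub>2 = 0 \<longrightarrow>
          surface_deriv s X p e\<^sub>1 \<bullet> e\<^sub>1 + surface_deriv s X p e\<^sub>2 \<bullet> e\<^sub>2 = 0)"

definition div_free_fields :: "real \<Rightarrow> (real^3 \<Rightarrow> real^3) set" where
  "div_free_fields s = {X. smooth_vector_field s X \<and> divergence_free s X}"

section \<open>Volume form and integration\<close>

text \<open>The area form for the outward orientation: contraction of the Euclidean volume form with the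
  outward unit normal.\<close>

definition volume_form :: "real \<Rightarrow> real^3 \<Rightarrow> real^3 \<Rightarrow> real^3 \<Rightarrow> real" where
  "volume_form s p u v = sgn (conormal s p) \<bullet> cross3 u v"

text \<open>Longitude \<open>\<theta>\<close> and reduced latitude \<open>\<phi>\<close>.  On the open box \<open>0 < \<theta> < 2\<pi>\<close>, \<open>-\<pi>/2 < \<phi> < \<pi>/2\<close> this is a
  positively oriented parametrization of the surface minus one meridian.  The integral of \<open>f \<mu>\<close>
  is the integral of the pulled back 2-form over this box.\<close>

definition chart :: "real \<Rightarrow> real \<times> real \<Rightarrow> real^3" where
  "chart s = (\<lambda>(\<theta>, \<phi>). vector [s * cos \<phi> * cos \<theta>, s * cos \<phi> * sin \<theta>, sin \<phi>])"

definition surface_integral :: "real \<Rightarrow> (real^3 \<Rightarrow> real) \<Rightarrow> real" where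
  "surface_integral s f =
     set_lebesgue_integral lborel (box (0, -pi/2) (2*pi, pi/2))
       (\<lambda>q. f (chart s q) *
            volume_form s (chart s q)
              (frechet_derivative (chart s) (at q) (1, 0))
              (frechet_derivative (chart s) (at q) (0, 1)))"

section \<open>The Lie algebra and its central extension\<close>

definition vf_inner :: "real \<Rightarrow> (real^3 \<Rightarrow> real^3) \<Rightarrow> (real^3 \<Rightarrow> real^3) \<Rightarrow> real" where
  "vf_inner s X Y = surface_integral s (\<lambda>p. X p \<bullet> Y p)"

definition eta_form :: "real \<Rightarrow> real^3 \<Rightarrow> real^3 \<Rightarrow> real^3 \<Rightarrow> real" where
  "eta_form s p u v = p$3 * volume_form s p u v"

definition cocycle :: "real \<Rightarrow> (real^3 \<Rightarrow> real^3) \<Rightarrow> (real^3 \<Rightarrow> real^3) \<Rightarrow> real" where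
  "cocycle s X Y = surface_integral s (\<lambda>p. eta_form s p (X p) (Y p))"

type_synonym extended_field = "(real^3 \<Rightarrow> real^3) \<times> real"

definition ext_bracket :: "real \<Rightarrow> extended_field \<Rightarrow> extended_field \<Rightarrow> extended_field" where
  "ext_bracket s = (\<lambda>(X, a) (Y, b). (vf_bracket s X Y, cocycle s X Y))"

definition ext_inner :: "real \<Rightarrow> extended_field \<Rightarrow> extended_field \<Rightarrow> real" where
  "ext_inner s = (\<lambda>(X, a) (Y, b). vf_inner s X Y + a * b)"

definition misiolek_curvature ::
  "('h \<Rightarrow> 'h \<Rightarrow> 'h) \<Rightarrow> ('h \<Rightarrow> 'h \<Rightarrow> real) \<Rightarrow> 'h \<Rightarrow> 'h \<Rightarrow> real" where
  "misiolek_curvature br ip X Y =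
     - (sqrt (ip (br X Y) (br X Y)))\<^sup>2 - ip X (br (br X Y) Y)"

section \<open>Zonal flows\<close>

definition zonal_flow :: "real \<Rightarrow> (real \<Rightarrow> real) \<Rightarrow> (real^3 \<Rightarrow> real^3) \<Rightarrow> bool" where
  "zonal_flow s F Z \<longleftrightarrow>
     smooth_vector_field s Z \<and>
     (\<forall>p\<in>ellipsoid s. Z p = F (p$3) *\<^sub>R vector [- p$2, p$1, 0])"

text \<open>On the surface \<open>z\<close> ranges over \<open>[-1, 1]\<close>; values of \<open>F\<close> elsewhere are irrelevant.\<close>

definition west_facing :: "(real \<Rightarrow> real) \<Rightarrow> bool" where
  "west_facing F \<longleftrightarrow> (\<forall>z\<in>{-1..1}. F z \<le> 0)"

definition vf_support :: "real \<Rightarrow> (real^3 \<Rightarrow> real^3) \<Rightarrow> (real^3) set" where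
  "vf_support s X = closure {p \<in> ellipsoid s. X p \<noteq> 0}"

end

theory Submission
  imports Defs
begin

text \<open>Write \<open>Z = f(z) \<partial>\<^sub>\<theta>\<close>, \<open>c\<^sup>2 = s\<^sup>2 (1 - z\<^sup>2)\<close> and let \<open>g(z) = 1 / (s \<surd>(1 + (s\<^sup>2 - 1) z\<^sup>2))\<close>, so that
  \<open>\<mu> = g\<inverse> d\<theta> \<and> dz\<close>.  Take for \<open>Y\<close> the field with stream function \<open>y = c sin \<theta>\<close>.  Then \<open>\<Omega>(Z,Y) = 0\<close>, so the
  curvature does not depend on \<open>b\<close>, and after integrating out \<open>\<theta>\<close> and integrating by parts in \<open>z\<close> all
  derivatives of \<open>f\<close> disappear: the curvature is \<open>\<pi> \<integral> c\<^sup>2 (c\<^sup>2 (s\<^sup>2 - 1) g\<^sup>3 f\<^sup>2 - a f) dz\<close>.  Both summands are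
  nonnegative for \<open>s > 1\<close>, \<open>a > 0\<close>, \<open>f \<le> 0\<close>.\<close>

section \<open>Derivatives along the surface\<close>

text \<open>Rewrites a vector literal as a linear combination of axis vectors, to which the general
  rules for derivatives and continuity apply.\<close>

lemma vector_3_axis:
  "(vector [a, b, c] :: real^3) = a *\<^sub>R axis 1 1 + b *\<^sub>R axis 2 1 + c *\<^sub>R axis 3 1"
  by (simp add: vec_eq_iff forall_3 axis_def)

lemma has_derivative_vector_3 [derivative_intros]:
  assumes "(f has_derivative f') F" "(g has_derivative g') F" "(h has_derivative h') F"
  shows "((\<lambda>p. vector [f p, g p, h p] :: real^3) has_derivative
           (\<lambda>v. vector [f' v, g' v, h' v])) F"
  unfolding vector_3_axis
  by (intro derivative_intros assms)

lemma continuous_on_vector_3 [continuous_intros]: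
  fixes f g h :: "'a::topological_space \<Rightarrow> real"
  assumes "continuous_on S f" "continuous_on S g" "continuous_on S h"
  shows "continuous_on S (\<lambda>p. vector [f p, g p, h p] :: real^3)"
  unfolding vector_3_axis
  by (intro continuous_intros assms)

lemma inner_3: "(u :: real^3) \<bullet> v = u$1 * v$1 + u$2 * v$2 + u$3 * v$3"
  by (simp add: inner_vec_def sum_3)

lemma has_derivative_vec_nth_id [derivative_intros]:
  "((\<lambda>p::real^'n. p$i) has_derivative (\<lambda>v. v$i)) F"
  by (rule bounded_linear_imp_has_derivative) (rule bounded_linear_vec_nth)

lemma has_derivative_height:
  assumes "(h has_real_derivative h') (at ((p::real^3)$3))"
  shows "((\<lambda>p::real^3. h (p$3)) has_derivative (\<lambda>v. v$3 * h')) (at p)"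
  by (rule DERIV_compose_FDERIV[OF assms has_derivative_vec_nth_id])

text \<open>The curve \<open>(p + t v) / \<surd>(1 + k t\<^sup>2)\<close> stays on the surface because the defining quadratic
  form takes the value \<open>1 + k t\<^sup>2\<close> at \<open>p + t v\<close>.\<close>

lemma ellipsoid_curve:
  assumes s: "s \<noteq> 0" and p: "p \<in> ellipsoid s" and v: "v \<in> tangent_plane s p"
  obtains \<gamma> where "\<gamma> (0::real) = p" "\<And>t. \<gamma> t \<in> ellipsoid s" "(\<gamma> has_vector_derivative v) (at 0)"
proof -
  define k where "k = ((v$1)\<^sup>2 + (v$2)\<^sup>2) / s\<^sup>2 + (v$3)\<^sup>2"
  define c where "c t = inverse (sqrt (1 + k * t\<^sup>2))" for t :: real
  define \<gamma> where "\<gamma> t = c t *\<^sub>R (p + t *\<^sub>R v)" for t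
  have k: "k \<ge> 0" by (simp add: k_def)
  have pos: "1 + k * t\<^sup>2 > 0" for t using k by (smt (verit) mult_nonneg_nonneg zero_le_power2)
  have p': "(p$1)\<^sup>2 + (p$2)\<^sup>2 = s\<^sup>2 * (1 - (p$3)\<^sup>2)" using p by (simp add: ellipsoid_def)
  have v': "v$1 * p$1 + v$2 * p$2 + s\<^sup>2 * (v$3 * p$3) = 0"
    using v by (simp add: tangent_plane_def conormal_def inner_3 mult_ac)
  have "\<gamma> t \<in> ellipsoid s" for t
  proof -
    have c2: "(c t)\<^sup>2 * (1 + k * t\<^sup>2) = 1"
      using pos[of t] by (simp add: c_def power_inverse)
    have sk: "s\<^sup>2 * k = (v$1)\<^sup>2 + (v$2)\<^sup>2 + s\<^sup>2 * (v$3)\<^sup>2"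
      using s by (simp add: k_def field_simps)
    \<comment> \<open>The term linear in t is the pairing of \<open>v\<close> with the conormal, so
      tangency removes it.\<close>
    have "(p$1 + t * v$1)\<^sup>2 + (p$2 + t * v$2)\<^sup>2 + s\<^sup>2 * (p$3 + t * v$3)\<^sup>2
        = ((p$1)\<^sup>2 + (p$2)\<^sup>2 + s\<^sup>2 * (p$3)\<^sup>2) + 2 * t * (v$1 * p$1 + v$2 * p$2 + s\<^sup>2 * (v$3 * p$3))
          + t\<^sup>2 * ((v$1)\<^sup>2 + (v$2)\<^sup>2 + s\<^sup>2 * (v$3)\<^sup>2)"
      by algebra
    also have "\<dots> = s\<^sup>2 * (1 + k * t\<^sup>2)"
      unfolding v' sk[symmetric] using p' by algebra
    finally have "(c t)\<^sup>2 * ((p$1 + t * v$1)\<^sup>2 + (p$2 + t * v$2)\<^sup>2 + s\<^sup>2 * (p$3 + t * v$3)\<^sup>2) = s\<^sup>2"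
      using c2 by algebra
    then show ?thesis
      by (simp add: ellipsoid_def \<gamma>_def algebra_simps power2_eq_square)
  qed
  moreover have "\<gamma> 0 = p" by (simp add: \<gamma>_def c_def)
  moreover have "(\<gamma> has_vector_derivative v) (at 0)"
  proof -
    \<comment> \<open>\<open>c\<close> is even in t, so rescaling does not change the velocity at
      0.\<close>
    have "(c has_real_derivative 0) (at 0)"
      unfolding c_def by (auto intro!: derivative_eq_intros)
    then show ?thesis
      unfolding \<gamma>_def
      by (auto intro!: derivative_eq_intros simp: c_def)
  qed
  ultimately show thesis using that by blast
qed

text \<open>Both values are the velocity of X along a curve in the surface that leaves p with
  velocity v. This matters because \<open>frechet_derivative\<close> within the surface is only some
  choice of derivative.\<close>

lemma has_derivative_ellipsoid_unique:
  fixes X :: "real^3 \<Rightarrow> real^3"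
  assumes "s \<noteq> 0" "p \<in> ellipsoid s" "v \<in> tangent_plane s p"
    and D: "(X has_derivative D) (at p within ellipsoid s)"
    and D': "(X has_derivative D') (at p within ellipsoid s)"
  shows "D v = D' v"
proof -
  obtain \<gamma> where \<gamma>: "\<gamma> (0::real) = p" "\<And>t. \<gamma> t \<in> ellipsoid s"
      "(\<gamma> has_vector_derivative v) (at 0)"
    using ellipsoid_curve assms by metis
  have *: "(X \<circ> \<gamma> has_vector_derivative E v) (at 0)"
    if "(X has_derivative E) (at p within ellipsoid s)" for E
  proof -
    have "(X has_derivative E) (at (\<gamma> 0) within range \<gamma>)"
      using that \<gamma> by (auto intro: has_derivative_subset)
    then show ?thesis
      using vector_derivative_diff_chain_within[of \<gamma> v 0 UNIV X E] \<gamma> by simp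
  qed
  show ?thesis using *[OF D] *[OF D'] by (rule vector_derivative_unique_at)
qed

text \<open>The ambient derivative is one derivative within the surface, and on tangent vectors the
  chosen one must agree with it. All surface derivatives below are computed in this way from
  explicit formulas on the whole space.\<close>

lemma surface_deriv_eq:
  assumes s: "s \<noteq> 0" and p: "p \<in> ellipsoid s" and v: "v \<in> tangent_plane s p"
    and X': "\<And>q. q \<in> ellipsoid s \<Longrightarrow> X q = X' q" and D: "(X' has_derivative D) (at p)"
  shows "surface_deriv s X p v = D v"
proof -
  have "(X' has_derivative D) (at p within ellipsoid s)"
    using D by (rule has_derivative_at_withinI)
  then have XD: "(X has_derivative D) (at p within ellipsoid s)"
    using X' p by (metis has_derivative_transform)
  then have "X differentiable (at p within ellipsoid s)"
    unfolding differentiable_def by blast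
  then have "(X has_derivative frechet_derivative X (at p within ellipsoid s)) (at p within ellipsoid s)"
    by (simp add: frechet_derivative_works)
  then show ?thesis
    unfolding surface_deriv_def
    using has_derivative_ellipsoid_unique[OF s p v _ XD] by blast
qed

text \<open>On the surface this is the reciprocal of the norm of the conormal.\<close>

definition recip_norm :: "real \<Rightarrow> real \<Rightarrow> real" where
  "recip_norm s z = inverse (s * sqrt (1 + (s\<^sup>2 - 1) * z\<^sup>2))"

text \<open>The derivative of \<open>recip_norm s\<close>. In the cubic form no new square root
  appears, so later identities are polynomial in z and \<open>recip_norm s z\<close>.\<close>

definition recip_norm' :: "real \<Rightarrow> real \<Rightarrow> real" where
  "recip_norm' s z = - (s\<^sup>2 - 1) * s\<^sup>2 * z * (recip_norm s z)^3"

context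
  fixes s :: real
  assumes s: "s > 1"
begin

lemma recip_norm_radicand_pos: "1 + (s\<^sup>2 - 1) * z\<^sup>2 > 0"
proof -
  have "s\<^sup>2 \<ge> 1" using s by simp
  then have "(s\<^sup>2 - 1) * z\<^sup>2 \<ge> 0" by simp
  then show ?thesis by linarith
qed

lemma recip_norm_gt_0: "recip_norm s z > 0"
  unfolding recip_norm_def using recip_norm_radicand_pos[of z] s by simp

text \<open>The polynomial relation by which later computations eliminate the square root.\<close>

lemma recip_norm_sq: "(recip_norm s z)\<^sup>2 * (s\<^sup>2 * (1 + (s\<^sup>2 - 1) * z\<^sup>2)) = 1"
proof -
  define q where "q = 1 + (s\<^sup>2 - 1) * z\<^sup>2"
  have "q > 0" using recip_norm_radicand_pos q_def by simp
  then show ?thesis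
    unfolding recip_norm_def q_def[symmetric] using s
    by (simp add: power_inverse power_mult_distrib field_simps)
qed

lemma recip_norm_deriv:
  "(recip_norm s has_real_derivative recip_norm' s z) (at z)"
proof -
  define r where "r = sqrt (1 + (s\<^sup>2 - 1) * z\<^sup>2)"
  have r: "r > 0" using recip_norm_radicand_pos r_def by simp
  have "(recip_norm s has_real_derivative
     - (inverse (s * r) * (s * (inverse r / 2 * ((s\<^sup>2 - 1) * (2*z)))) * inverse (s * r))) (at z)"
    unfolding recip_norm_def r_def using recip_norm_radicand_pos[of z] s
    by (auto intro!: derivative_eq_intros)
  moreover have "- (inverse (s * r) * (s * (inverse r / 2 * ((s\<^sup>2 - 1) * (2*z)))) * inverse (s * r))
     = recip_norm' s z"
    unfolding recip_norm'_def recip_norm_def r_def[symmetric] using r s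
    by (simp add: divide_simps) algebra
  ultimately show ?thesis by simp
qed

end

section \<open>The field with stream function \<open>y\<close> and its brackets\<close>

text \<open>This class consists of smooth functions because it is closed under directional derivatives: the
  derivative of \<open>recip_norm s\<close> is a polynomial in \<open>z\<close> and \<open>recip_norm s\<close>.\<close>

inductive smooth_class :: "real \<Rightarrow> (real^3 \<Rightarrow> 'b::real_normed_vector) \<Rightarrow> bool" for s where
  const: "smooth_class s (\<lambda>p. c)"
| add: "smooth_class s f \<Longrightarrow> smooth_class s g \<Longrightarrow> smooth_class s (\<lambda>p. f p + g p)"
| scale: "smooth_class s f \<Longrightarrow> smooth_class s (\<lambda>p. c *\<^sub>R f p)"
| coord: "smooth_class s f \<Longrightarrow> smooth_class s (\<lambda>p. p$i *\<^sub>R f p)"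
| recip_norm: "smooth_class s f \<Longrightarrow> smooth_class s (\<lambda>p. recip_norm s (p$3) *\<^sub>R f p)"

text \<open>The divergence-free field with stream function \<open>y\<close>, i.e. the cross product of the second unit
  vector with the outward unit normal.\<close>

definition stream_field :: "real \<Rightarrow> real^3 \<Rightarrow> real^3" where
  "stream_field s p = recip_norm s (p$3) *\<^sub>R vector [s\<^sup>2 * p$3, 0, - p$1]"

definition stream_field_deriv :: "real \<Rightarrow> real^3 \<Rightarrow> real^3 \<Rightarrow> real^3" where
  "stream_field_deriv s p v = (recip_norm' s (p$3) * v$3) *\<^sub>R vector [s\<^sup>2 * p$3, 0, - p$1]
     + recip_norm s (p$3) *\<^sub>R vector [s\<^sup>2 * v$3, 0, - v$1]"

text \<open>Given on the whole space, so that ordinary derivatives at points of the surface can be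
  taken.\<close>

definition zonal_ext :: "(real \<Rightarrow> real) \<Rightarrow> real^3 \<Rightarrow> real^3" where
  "zonal_ext f p = f (p$3) *\<^sub>R vector [- p$2, p$1, 0]"

text \<open>The closed form of the bracket of a zonal field with \<open>stream_field s\<close>,
  again on the whole space so that it can be bracketed once more. \<open>f'\<close> stands for the
  derivative of \<open>f\<close>.\<close>

definition zonal_bracket :: "real \<Rightarrow> (real \<Rightarrow> real) \<Rightarrow> (real \<Rightarrow> real) \<Rightarrow> real^3 \<Rightarrow> real^3" where
  "zonal_bracket s f f' p = recip_norm s (p$3) *\<^sub>R
     vector [- f' (p$3) * p$1 * p$2, f' (p$3) * (p$1)\<^sup>2 - s\<^sup>2 * f (p$3) * p$3, f (p$3) * p$2]"

section \<open>Tangency of the explicit fields\<close>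

lemma tangent_plane_iff: "v \<in> tangent_plane s p \<longleftrightarrow> v$1 * p$1 + v$2 * p$2 + s\<^sup>2 * (v$3 * p$3) = 0"
  by (simp add: tangent_plane_def conormal_def inner_3 mult_ac)

lemma stream_field_tangent: "stream_field s p \<in> tangent_plane s p"
  by (simp add: tangent_plane_iff stream_field_def)

lemma zonal_ext_tangent: "zonal_ext f p \<in> tangent_plane s p"
  by (simp add: tangent_plane_iff zonal_ext_def)

lemma zonal_bracket_tangent: "zonal_bracket s f f' p \<in> tangent_plane s p"
  unfolding tangent_plane_iff zonal_bracket_def by (simp add: power2_eq_square algebra_simps)

context
  fixes s :: real
  assumes s: "s > 1"
begin

lemma smooth_class_deriv:
  "smooth_class s f \<Longrightarrow>
     \<exists>D. (\<forall>p. (f has_derivative D p) (at p)) \<and> (\<forall>v. smooth_class s (\<lambda>p. D p v))"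
proof (induction rule: smooth_class.induct)
  case (const c)
  then show ?case
    by (intro exI[of _ "\<lambda>p v. 0"]) (auto intro: smooth_class.intros)
next
  case (add f g)
  then obtain D E where "\<forall>p. (f has_derivative D p) (at p)" "\<forall>v. smooth_class s (\<lambda>p. D p v)"
    "\<forall>p. (g has_derivative E p) (at p)" "\<forall>v. smooth_class s (\<lambda>p. E p v)"
    by blast
  then show ?case
    by (intro exI[of _ "\<lambda>p v. D p v + E p v"]) (auto intro!: smooth_class.intros derivative_intros)
next
  case (scale f c)
  then obtain D where "\<forall>p. (f has_derivative D p) (at p)" "\<forall>v. smooth_class s (\<lambda>p. D p v)"
    by blast
  then show ?case
    by (intro exI[of _ "\<lambda>p v. c *\<^sub>R D p v"]) (auto intro!: smooth_class.scale derivative_intros)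
next
  case (coord f i)
  then obtain D where D: "\<forall>p. (f has_derivative D p) (at p)" "\<forall>v. smooth_class s (\<lambda>p. D p v)"
    by blast
  have "((\<lambda>p. p$i *\<^sub>R f p) has_derivative (\<lambda>v. p$i *\<^sub>R D p v + v$i *\<^sub>R f p)) (at p)" for p
    by (rule has_derivative_scaleR[OF has_derivative_vec_nth_id]) (use D in auto)
  then show ?case
    using D coord.hyps
    by (intro exI[of _ "\<lambda>p v. p$i *\<^sub>R D p v + v$i *\<^sub>R f p"])
       (auto intro!: smooth_class.intros(2-5))
next
  case (recip_norm f)
  then obtain D where D: "\<forall>p. (f has_derivative D p) (at p)" "\<forall>v. smooth_class s (\<lambda>p. D p v)"
    by blast
  let ?D = "\<lambda>p v. recip_norm s (p$3) *\<^sub>R D p v + (v$3 * recip_norm' s (p$3)) *\<^sub>R f p"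
  have "((\<lambda>p. recip_norm s (p$3) *\<^sub>R f p) has_derivative ?D p) (at p)" for p
    by (rule has_derivative_scaleR[OF has_derivative_height[OF recip_norm_deriv[OF s]]]) (use D in auto)
  moreover have "smooth_class s (\<lambda>p. ?D p v)" for v
  proof -
    \<comment> \<open>The derivative of the scalar factor becomes a constant times iterated
      multiplications by the height and by \<open>recip_norm s\<close>, the operations that generate
      the class.\<close>
    have eq: "(\<lambda>p. ?D p v) = (\<lambda>p. recip_norm s (p$3) *\<^sub>R D p v + (- (v$3) * (s\<^sup>2 - 1) * s\<^sup>2) *\<^sub>R (p$3 *\<^sub>R
      recip_norm s (p$3) *\<^sub>R recip_norm s (p$3) *\<^sub>R recip_norm s (p$3) *\<^sub>R f p))"
      by (auto simp: fun_eq_iff recip_norm'_def power3_eq_cube algebra_simps)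
    show ?thesis
      unfolding eq using D recip_norm.hyps by (intro smooth_class.intros(2-5)) auto
  qed
  ultimately show ?case by (intro exI[of _ ?D]) auto
qed

text \<open>Induction on k with f arbitrary: every directional derivative lies in the class
  again.\<close>

lemma smooth_class_ck_on: "smooth_class s f \<Longrightarrow> ck_on k UNIV f"
proof (induction k arbitrary: f)
  case 0
  then obtain D where "\<And>p. (f has_derivative D p) (at p)"
    using smooth_class_deriv by blast
  then show ?case
    by (auto intro!: continuous_at_imp_continuous_on has_derivative_continuous)
next
  case (Suc k)
  then obtain D where D: "\<And>p. (f has_derivative D p) (at p)" "\<And>v. smooth_class s (\<lambda>p. D p v)"
    using smooth_class_deriv by blast
  then have "frechet_derivative f (at p) = D p" for p
    by (metis frechet_derivative_at)
  with D Suc.IH show ?case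
    by (auto simp: differentiable_def)
qed

lemma stream_field_smooth: "smooth_on UNIV (stream_field s)"
proof -
  have eq: "stream_field s = (\<lambda>p. recip_norm s (p$3) *\<^sub>R (p$3 *\<^sub>R (s\<^sup>2 *\<^sub>R axis 1 1) + p$1 *\<^sub>R (- axis 3 1)))"
    by (auto simp: stream_field_def fun_eq_iff vector_3_axis)
  have "smooth_class s (stream_field s)"
    unfolding eq by (intro smooth_class.recip_norm smooth_class.add smooth_class.coord smooth_class.const)
  then show ?thesis
    by (simp add: smooth_on_def smooth_class_ck_on)
qed

lemma stream_field_has_derivative:
  "(stream_field s has_derivative stream_field_deriv s p) (at p)"
proof -
  have "((\<lambda>p. recip_norm s (p$3) *\<^sub>R vector [s\<^sup>2 * p$3, 0, - p$1] :: real^3) has_derivative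
    (\<lambda>v. recip_norm s (p$3) *\<^sub>R vector [s\<^sup>2 * v$3, 0, - v$1]
       + (v$3 * recip_norm' s (p$3)) *\<^sub>R vector [s\<^sup>2 * p$3, 0, - p$1])) (at p)"
    by (intro has_derivative_scaleR has_derivative_height[OF recip_norm_deriv[OF s]] derivative_intros)
  then show ?thesis
    by (simp add: stream_field_def[abs_def] stream_field_deriv_def[abs_def] add.commute mult.commute)
qed

text \<open>The surface equation turns the squared norm of the conormal into a function of the
  height alone.\<close>

lemma recip_norm_conormal:
  assumes "p \<in> ellipsoid s"
  shows "(recip_norm s (p$3))\<^sup>2 * (conormal s p \<bullet> conormal s p) = 1"
proof -
  have pe: "(p$1)\<^sup>2 + (p$2)\<^sup>2 = s\<^sup>2 * (1 - (p$3)\<^sup>2)" using assms by (simp add: ellipsoid_def)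
  have "conormal s p \<bullet> conormal s p = (p$1)\<^sup>2 + (p$2)\<^sup>2 + s\<^sup>2 * s\<^sup>2 * (p$3)\<^sup>2"
    by (simp add: inner_3 conormal_def power2_eq_square)
  also have "\<dots> = s\<^sup>2 * (1 + (s\<^sup>2 - 1) * (p$3)\<^sup>2)"
    unfolding pe by algebra
  finally show ?thesis using recip_norm_sq[OF s, of "p$3"] by simp
qed

lemma sgn_conormal:
  assumes "p \<in> ellipsoid s"
  shows "sgn (conormal s p) = recip_norm s (p$3) *\<^sub>R conormal s p"
proof -
  let ?g = "recip_norm s (p$3)"
  have "(?g * norm (conormal s p))\<^sup>2 = 1"
    using recip_norm_conormal[OF assms] by (simp add: power_mult_distrib power2_norm_eq_inner)
  moreover have g: "?g > 0" by (rule recip_norm_gt_0[OF s])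
  ultimately have "?g * norm (conormal s p) = 1"
    by (simp add: power2_eq_1_iff) (smt (verit) mult_nonneg_nonneg norm_ge_zero)
  then have "?g = inverse (norm (conormal s p))"
    by (metis inverse_unique mult.commute)
  then show ?thesis by (simp add: sgn_div_norm)
qed

text \<open>An orthonormal tangent frame together with the unit normal forms an orthogonal matrix,
  whose columns are orthonormal as well.\<close>

lemma tangent_frame_sum:
  assumes p: "p \<in> ellipsoid s" and e: "e1 \<in> tangent_plane s p" "e2 \<in> tangent_plane s p"
    and on: "norm e1 = 1" "norm e2 = 1" "e1 \<bullet> e2 = 0"
  shows "e1$i * e1$j + e2$i * e2$j =
    (if i = j then 1 else 0) - (recip_norm s (p$3))\<^sup>2 * (conormal s p $ i * conormal s p $ j)"
proof -
  define g where "g = recip_norm s (p$3)"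
  have N: "g\<^sup>2 * (conormal s p \<bullet> conormal s p) = 1"
    using recip_norm_conormal[OF p] by (simp add: g_def)
  define n where "n = g *\<^sub>R conormal s p"
  have n: "n \<bullet> n = 1" "e1 \<bullet> n = 0" "e2 \<bullet> n = 0"
    using N e by (simp_all add: n_def tangent_plane_def power2_eq_square mult_ac)
  have e1: "e1 \<bullet> e1 = 1" "e2 \<bullet> e2 = 1" using on by (simp_all add: norm_eq_1)
  define A :: "real^3^3" where "A = vector [e1, e2, n]"
  have "A ** transpose A = mat 1"
    using n e1 on(3)
    by (simp add: vec_eq_iff forall_3 matrix_matrix_mult_def transpose_def mat_def A_def sum_3 inner_3 mult_ac)
  then have "transpose A ** A = mat 1" by (rule matrix_left_right_inverse[THEN iffD1])
  then have "(transpose A ** A) $ i $ j = mat 1 $ i $ j" by simp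
  then have "e1$i * e1$j + e2$i * e2$j + n$i * n$j = (if i = j then 1 else 0)"
    by (simp add: matrix_matrix_mult_def transpose_def mat_def A_def sum_3)
  then show ?thesis
    by (simp add: n_def g_def power2_eq_square mult_ac)
qed

text \<open>The trace is linear in the products of frame components, and their sums over an
  orthonormal frame depend on the normal only. No particular frame has to be chosen.\<close>

lemma stream_field_div_free: "divergence_free s (stream_field s)"
  unfolding divergence_free_def
proof (intro ballI impI, elim conjE)
  fix p e1 e2
  assume p: "p \<in> ellipsoid s" and e: "e1 \<in> tangent_plane s p" "e2 \<in> tangent_plane s p"
    and on: "norm e1 = 1" "norm e2 = 1" "e1 \<bullet> e2 = 0"
  have sd: "surface_deriv s (stream_field s) p v = stream_field_deriv s p v"
    if "v \<in> tangent_plane s p" for v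
    using surface_deriv_eq[OF _ p that refl stream_field_has_derivative] s by simp
  have eq: "stream_field_deriv s p v \<bullet> v = recip_norm' s (p$3) * (s\<^sup>2 * p$3 * (v$1 * v$3) - p$1 * (v$3 * v$3))
     + recip_norm s (p$3) * (s\<^sup>2 - 1) * (v$1 * v$3)" for v
    by (simp add: stream_field_deriv_def inner_3 algebra_simps)
  have "stream_field_deriv s p e1 \<bullet> e1 + stream_field_deriv s p e2 \<bullet> e2
    = recip_norm' s (p$3) * (s\<^sup>2 * p$3 * (e1$1 * e1$3 + e2$1 * e2$3) - p$1 * (e1$3 * e1$3 + e2$3 * e2$3))
      + recip_norm s (p$3) * (s\<^sup>2 - 1) * (e1$1 * e1$3 + e2$1 * e2$3)"
    unfolding eq by (simp add: algebra_simps)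
  \<comment> \<open>Inside the first bracket the normal contributions cancel. What remains is
    \<open>recip_norm'\<close> times minus the first coordinate, and the last summand cancels
    it.\<close>
  also have "\<dots> = 0"
    unfolding tangent_frame_sum[OF p e on]
    by (simp add: conormal_def recip_norm'_def) algebra
  finally show "surface_deriv s (stream_field s) p e1 \<bullet> e1 + surface_deriv s (stream_field s) p e2 \<bullet> e2 = 0"
    using e by (simp add: sd)
qed

lemma stream_field_in: "stream_field s \<in> div_free_fields s"
  unfolding div_free_fields_def smooth_vector_field_def
  using stream_field_tangent stream_field_smooth stream_field_div_free by blast

text \<open>A zonal field has no vertical component, so \<open>recip_norm\<close> is constant along
  it and its derivative does not enter.\<close>

lemma vf_bracket_zonal:
  assumes f: "\<And>z. (f has_real_derivative f' z) (at z)"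
    and Z: "\<And>q. q \<in> ellipsoid s \<Longrightarrow> Z q = zonal_ext f q" and p: "p \<in> ellipsoid s"
  shows "vf_bracket s Z (stream_field s) p = zonal_bracket s f f' p"
proof -
  have "((\<lambda>p. f (p$3) *\<^sub>R vector [- p$2, p$1, 0] :: real^3) has_derivative
    (\<lambda>v. f (p$3) *\<^sub>R vector [- v$2, v$1, 0] + (v$3 * f' (p$3)) *\<^sub>R vector [- p$2, p$1, 0])) (at p)"
    by (intro has_derivative_scaleR has_derivative_height[OF f] derivative_intros)
  then have D: "(zonal_ext f has_derivative
    (\<lambda>v. f (p$3) *\<^sub>R vector [- v$2, v$1, 0] + (v$3 * f' (p$3)) *\<^sub>R vector [- p$2, p$1, 0])) (at p)"
    by (simp add: zonal_ext_def[abs_def])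
  have "s \<noteq> 0" using s by simp
  then have d1: "surface_deriv s Z p (stream_field s p) =
    f (p$3) *\<^sub>R vector [- stream_field s p$2, stream_field s p$1, 0] + (stream_field s p$3 * f' (p$3)) *\<^sub>R vector [- p$2, p$1, 0]"
    using surface_deriv_eq[OF _ p stream_field_tangent, of Z, OF _ Z D] by simp
  have "Z p \<in> tangent_plane s p" using zonal_ext_tangent Z p by metis
  note d2 = surface_deriv_eq[OF \<open>s \<noteq> 0\<close> p this refl stream_field_has_derivative]
  show ?thesis
    unfolding vf_bracket_def d1 d2
    by (simp add: Z p vec_eq_iff forall_3 zonal_bracket_def zonal_ext_def stream_field_def
        stream_field_deriv_def power2_eq_square algebra_simps)
qed

text \<open>The integrand of the last term of the curvature, where W is the bracket of Z with the
  stream field. In the final identity the surface equation serves to replace x^2 + y^2 by a function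
  of z.\<close>

lemma zonal_inner_bracket_bracket:
  assumes f: "\<And>z. (f has_real_derivative f' z) (at z)"
    and f': "\<And>z. (f' has_real_derivative f'' z) (at z)"
    and W: "\<And>q. q \<in> ellipsoid s \<Longrightarrow> W q = zonal_bracket s f f' q" and p: "p \<in> ellipsoid s"
  defines "x \<equiv> p$1" and "y \<equiv> p$2" and "z \<equiv> p$3"
  defines "g \<equiv> recip_norm s z" and "g' \<equiv> recip_norm' s z"
  shows "zonal_ext f p \<bullet> vf_bracket s W (stream_field s) p =
     f z * g * ((g' * f' z + g * f'' z) * x\<^sup>2 * (s\<^sup>2 * (1 - z\<^sup>2))
       - s\<^sup>2 * y\<^sup>2 * (f z * (g' * z + g) + g * f' z * z)
       - s\<^sup>2 * x\<^sup>2 * (2 * g * f' z * z + (g' * f z + g * f' z) * z + g * f z))"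
proof -
  \<comment> \<open>Products are grouped so that the product rules yield exactly this
    expression.\<close>
  let ?D = "\<lambda>v. recip_norm s (p$3) *\<^sub>R vector
      [- (f' (p$3) * (p$1 * v$2 + v$1 * p$2) + v$3 * f'' (p$3) * (p$1 * p$2)),
       f' (p$3) * (2 * p$1 * v$1) + v$3 * f'' (p$3) * (p$1)\<^sup>2 - s\<^sup>2 * (f (p$3) * v$3 + v$3 * f' (p$3) * p$3),
       f (p$3) * v$2 + v$3 * f' (p$3) * p$2] +
     (v$3 * recip_norm' s (p$3)) *\<^sub>R vector [- (f' (p$3) * (p$1 * p$2)), f' (p$3) * (p$1)\<^sup>2 - s\<^sup>2 * (f (p$3) * p$3), f (p$3) * p$2]"
  have sq: "((\<lambda>p::real^3. (p$1)\<^sup>2) has_derivative (\<lambda>v. 2 * p$1 * v$1)) (at p)"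
    by (auto intro!: derivative_eq_intros)
  have "((\<lambda>p. recip_norm s (p$3) *\<^sub>R vector [- (f' (p$3) * (p$1 * p$2)), f' (p$3) * (p$1)\<^sup>2 - s\<^sup>2 * (f (p$3) * p$3), f (p$3) * p$2] :: real^3) has_derivative ?D) (at p)"
    by (intro has_derivative_scaleR has_derivative_vector_3 has_derivative_diff has_derivative_minus
        has_derivative_mult has_derivative_mult_right sq
        has_derivative_height[OF f] has_derivative_height[OF f'] has_derivative_height[OF recip_norm_deriv[OF s]] has_derivative_vec_nth_id)
  then have D: "(zonal_bracket s f f' has_derivative ?D) (at p)"
    by (simp add: zonal_bracket_def[abs_def] mult.assoc)
  have "s \<noteq> 0" using s by simp
  then have d1: "surface_deriv s W p (stream_field s p) = ?D (stream_field s p)"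
    using surface_deriv_eq[OF _ p stream_field_tangent, of W, OF _ W D] by simp
  have "W p \<in> tangent_plane s p" using zonal_bracket_tangent W p by metis
  note d2 = surface_deriv_eq[OF \<open>s \<noteq> 0\<close> p this refl stream_field_has_derivative]
  have pe: "s\<^sup>2 * (1 - z\<^sup>2) = x\<^sup>2 + y\<^sup>2" using p by (simp add: ellipsoid_def x_def y_def z_def)
  show ?thesis
    unfolding vf_bracket_def d1 d2 pe
    by (simp add: W p inner_3 zonal_bracket_def zonal_ext_def stream_field_def
        stream_field_deriv_def x_def y_def z_def g_def g'_def) (simp add: algebra_simps power2_eq_square)
qed

end

section \<open>Regularity of the profile of a zonal flow\<close>

text \<open>The derivatives are arguments, so that products carry explicit ones. Order two is what a
  double bracket needs, and continuity of \<open>f''\<close> makes the integrands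
  continuous.\<close>

definition C2_on :: "real set \<Rightarrow> (real \<Rightarrow> real) \<Rightarrow> (real \<Rightarrow> real) \<Rightarrow> (real \<Rightarrow> real) \<Rightarrow> bool" where
  "C2_on A f f' f'' \<longleftrightarrow> (\<forall>z\<in>A. (f has_real_derivative f' z) (at z) \<and>
     (f' has_real_derivative f'' z) (at z) \<and> isCont f'' z)"

lemma C2_on_mult:
  assumes "C2_on A f f' f''" "C2_on A g g' g''"
  shows "C2_on A (\<lambda>z. f z * g z) (\<lambda>z. f' z * g z + f z * g' z)
           (\<lambda>z. f'' z * g z + 2 * f' z * g' z + f z * g'' z)"
  unfolding C2_on_def
proof (intro ballI conjI)
  fix z assume "z \<in> A"
  then have d: "(f has_real_derivative f' z) (at z)" "(f' has_real_derivative f'' z) (at z)" "isCont f'' z"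
    "(g has_real_derivative g' z) (at z)" "(g' has_real_derivative g'' z) (at z)" "isCont g'' z"
    using assms by (auto simp: C2_on_def)
  show "((\<lambda>z. f z * g z) has_real_derivative f' z * g z + f z * g' z) (at z)"
    using DERIV_mult[OF d(1) d(4)] by (rule DERIV_cong) simp
  show "((\<lambda>z. f' z * g z + f z * g' z) has_real_derivative
      f'' z * g z + 2 * f' z * g' z + f z * g'' z) (at z)"
    using DERIV_add[OF DERIV_mult[OF d(2) d(4)] DERIV_mult[OF d(1) d(5)]]
    by (rule DERIV_cong) simp
  show "isCont (\<lambda>z. f'' z * g z + 2 * f' z * g' z + f z * g'' z) z"
    by (intro continuous_intros d(3,6) d(1,2,4,5)[THEN DERIV_isCont])
qed

text \<open>On an open set, agreement with g passes to the derivatives. Stating the result with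
  \<open>deriv\<close> gives pieces over different open sets the same derivative functions, so that
  they can be glued.\<close>

lemma C2_on_deriv:
  assumes A: "open A" and g: "C2_on A g g' g''" and eq: "\<And>z. z \<in> A \<Longrightarrow> f z = g z"
  shows "C2_on A f (deriv f) (deriv (deriv f))"
proof -
  have 1: "(f has_real_derivative g' z) (at z)" if "z \<in> A" for z
    
    using has_field_derivative_transform_within_open[OF _ A that eq[symmetric]] g that
    by (auto simp: C2_on_def)
  then have d1: "deriv f z = g' z" if "z \<in> A" for z
    using that by (simp add: DERIV_imp_deriv)
  have 2: "(deriv f has_real_derivative g'' z) (at z)" if "z \<in> A" for z
    
    using has_field_derivative_transform_within_open[OF _ A that d1[symmetric]] g that
    by (auto simp: C2_on_def)
  then have d2: "deriv (deriv f) z = g'' z" if "z \<in> A" for z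
    using that by (simp add: DERIV_imp_deriv)
  have "isCont (deriv (deriv f)) z" if "z \<in> A" for z
  proof -
    have "\<forall>\<^sub>F w in nhds z. deriv (deriv f) w = g'' w"
      using A that d2 eventually_nhds by blast
    then show ?thesis using g that by (simp add: isCont_cong C2_on_def)
  qed
  with 1 2 d1 d2 show ?thesis by (simp add: C2_on_def)
qed

text \<open>Parametrized by height in order to recover the profile from the field. The square root
  is not differentiable at the poles, hence the restriction to \<bar>z\<bar> < 1 below.\<close>

definition meridian :: "real \<Rightarrow> real \<Rightarrow> real^3" where
  "meridian s z = vector [s * sqrt (1 - z\<^sup>2), 0, z]"

lemma meridian_in_ellipsoid: "\<bar>z\<bar> \<le> 1 \<Longrightarrow> meridian s z \<in> ellipsoid s"
  by (simp add: meridian_def ellipsoid_def power_mult_distrib abs_le_square_iff[of z 1, simplified])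

lemma has_derivative_nth [derivative_intros]:
  "(f has_derivative f') F \<Longrightarrow> ((\<lambda>x. f x $ i) has_derivative (\<lambda>h. f' h $ i)) F"
  by (rule bounded_linear.has_derivative[OF bounded_linear_vec_nth])

text \<open>The chain rule, expressed by derivatives of X in two fixed directions. These are again
  maps on the space, so the lemma applies to them in turn.\<close>

lemma meridian_chain:
  fixes X :: "real^3 \<Rightarrow> real^3"
  assumes z: "\<bar>z\<bar> < 1" and X: "X differentiable (at (meridian s z))"
  defines "D \<equiv> frechet_derivative X (at (meridian s z))"
  shows "((\<lambda>z. X (meridian s z) $ i) has_real_derivative
     (s * - z / sqrt (1 - z\<^sup>2)) * D (axis 1 1) $ i + D (axis 3 1) $ i) (at z)"
proof -
  have DX: "(X has_derivative D) (at (meridian s z))"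
    using X by (simp add: D_def frechet_derivative_works)
  have z2: "z\<^sup>2 < 1" using z by (simp add: abs_square_less_1)
  have "((\<lambda>z. s * sqrt (1 - z\<^sup>2)) has_real_derivative s * - z / sqrt (1 - z\<^sup>2)) (at z)"
    using z2 by (auto intro!: derivative_eq_intros simp: divide_simps)
  then have "((\<lambda>z. s * sqrt (1 - z\<^sup>2)) has_derivative (\<lambda>h. (s * - z / sqrt (1 - z\<^sup>2)) * h)) (at z)"
    by (simp only: has_field_derivative_def)
  then have "(meridian s has_derivative (\<lambda>h. vector [(s * - z / sqrt (1 - z\<^sup>2)) * h, 0, h])) (at z)"
    unfolding meridian_def[abs_def] by (intro derivative_intros)
  from has_derivative_compose[OF this DX]
  have "((\<lambda>z. X (meridian s z) $ i) has_derivative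
    (\<lambda>h. D (vector [(s * - z / sqrt (1 - z\<^sup>2)) * h, 0, h]) $ i)) (at z)"
    by (rule has_derivative_nth)
  moreover have "linear D" using DX by (rule has_derivative_linear)
  then have "D (vector [a * h, 0, h]) $ i = (a * D (axis 1 1) $ i + D (axis 3 1) $ i) * h" for a h
    by (simp add: vector_3_axis linear_add linear_scale algebra_simps)
  ultimately show ?thesis
    by (simp only: has_field_derivative_def)
qed

lemma meridian_C2:
  fixes X :: "real^3 \<Rightarrow> real^3"
  assumes X: "ck_on 2 U X" and U: "\<And>z. \<bar>z\<bar> < 1 \<Longrightarrow> meridian s z \<in> U"
  shows "\<exists>h' h''. C2_on {-1<..<1} (\<lambda>z. X (meridian s z) $ i) h' h''"
proof -
  let ?D = "\<lambda>X (e::real^3) p. frechet_derivative X (at p) e :: real^3"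
  have ck: "\<And>p. p \<in> U \<Longrightarrow> X differentiable (at p)"
      "\<And>p e. p \<in> U \<Longrightarrow> ?D X e differentiable (at p)"
      "\<And>e e'. continuous_on U (?D (?D X e) e')"
    using X by (auto simp: numeral_2_eq_2)
  let ?\<gamma> = "meridian s" and ?e = "axis 1 1" and ?k = "axis 3 1"
  \<comment> \<open>\<open>c\<close> is the derivative of the first coordinate of the meridian, and
    \<open>c'\<close> is the derivative of \<open>c\<close>.\<close>
  define c c' where "c z = s * - z / sqrt (1 - z\<^sup>2)"
    and "c' z = - s * inverse (sqrt (1 - z\<^sup>2)) ^ 3" for z
  have dc: "(c has_real_derivative c' z) (at z)" if "\<bar>z\<bar> < 1" for z
  proof -
    define r where "r = sqrt (1 - z\<^sup>2)"
    have z2: "z\<^sup>2 < 1" using that by (simp add: abs_square_less_1)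
    then have r: "r > 0" "r\<^sup>2 = 1 - z\<^sup>2" by (simp_all add: r_def)
    have "(c has_real_derivative (- s * r - (s * - z) * (inverse r / 2 * (- (2 * z)))) / (r * r)) (at z)"
      unfolding c_def r_def using z2
      by (auto intro!: derivative_eq_intros simp: diff_divide_distrib add_divide_distrib)
    moreover have "(- s * r - (s * - z) * (inverse r / 2 * (- (2 * z)))) / (r * r) = - s * (r\<^sup>2 + z\<^sup>2) * inverse r ^ 3"
      using r(1) by (simp add: field_simps power2_eq_square power3_eq_cube)
    moreover have "\<dots> = c' z"
      using r(2) by (simp add: c'_def r_def)
    ultimately show ?thesis by simp
  qed
  have cont: "isCont (\<lambda>z. ?D (?D X e) e' (?\<gamma> z)) z" if "\<bar>z\<bar> < 1" for z e e'
  proof -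
    have "continuous_on {-1<..<1} (\<lambda>z. ?D (?D X e) e' (?\<gamma> z))"
      by (rule continuous_on_compose2[OF ck(3)])
        (auto simp: meridian_def intro!: continuous_intros U[unfolded meridian_def])
    then show ?thesis using that by (simp add: continuous_on_eq_continuous_at abs_less_iff)
  qed
  have contc': "isCont c' z" if "\<bar>z\<bar> < 1" for z
  proof -
    have "z\<^sup>2 < 1" using that by (simp add: abs_square_less_1)
    then show ?thesis unfolding c'_def by (intro continuous_intros) auto
  qed
  define h' where "h' z = c z * ?D X ?e (?\<gamma> z) $ i + ?D X ?k (?\<gamma> z) $ i" for z
  define d where "d e z = c z * ?D (?D X e) ?e (?\<gamma> z) $ i + ?D (?D X e) ?k (?\<gamma> z) $ i" for e z
  define h'' where "h'' z = c' z * ?D X ?e (?\<gamma> z) $ i + c z * d ?e z + d ?k z" for z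
  have "C2_on {-1<..<1} (\<lambda>z. X (?\<gamma> z) $ i) h' h''"
    unfolding C2_on_def
  proof (intro ballI conjI)
    fix z :: real assume "z \<in> {-1<..<1}"
    then have z: "\<bar>z\<bar> < 1" by auto
    show "((\<lambda>z. X (?\<gamma> z) $ i) has_real_derivative h' z) (at z)"
      unfolding h'_def c_def by (rule meridian_chain) (use z ck U in auto)
    have dd: "((\<lambda>z. ?D X e (?\<gamma> z) $ i) has_real_derivative d e z) (at z)" for e
      unfolding d_def c_def by (rule meridian_chain) (use z ck U in auto)
    show "(h' has_real_derivative h'' z) (at z)"
      unfolding h'_def h''_def
      using DERIV_add[OF DERIV_mult[OF dc[OF z] dd] dd] by (rule DERIV_cong) simp
    show "isCont h'' z"
      unfolding h''_def d_def
      by (intro continuous_intros DERIV_isCont[OF dd] DERIV_isCont[OF dc] contc' cont z)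
  qed
  then show ?thesis by blast
qed

text \<open>For \<bar>z\<bar> < 1 the profile is the second component of a smooth extension along
  the meridian, divided by s sqrt(1 - z^2). Near the poles it vanishes by the support condition. The
  two open pieces cover the line. The value 0 from the poles outwards is a default.\<close>

lemma zonal_profile_C2:
  assumes s: "s > 0" and Z: "zonal_flow s F Z"
    and supp: "vf_support s Z \<subseteq> ellipsoid s - {vector [0, 0, 1], vector [0, 0, -1]}"
  defines "f \<equiv> (\<lambda>z. if \<bar>z\<bar> < 1 then F z else 0)"
  shows "C2_on UNIV f (deriv f) (deriv (deriv f))"
    and "\<And>p. p \<in> ellipsoid s \<Longrightarrow> Z p = zonal_ext f p"
proof -
  obtain U X where U: "ellipsoid s \<subseteq> U" and X: "smooth_on U X"
    and XZ: "\<And>p. p \<in> ellipsoid s \<Longrightarrow> X p = Z p"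
    using Z by (auto simp: zonal_flow_def smooth_vector_field_def)
  have Zp: "Z p = F (p$3) *\<^sub>R vector [- p$2, p$1, 0]" if "p \<in> ellipsoid s" for p
    using Z that by (simp add: zonal_flow_def)
  have FZ: "Z (meridian s z) $ 2 = F z * (s * sqrt (1 - z\<^sup>2))" if "\<bar>z\<bar> < 1" for z
    using Zp[OF meridian_in_ellipsoid, of z] that by (simp add: meridian_def)
  \<comment> \<open>Heights whose meridian point misses the support. The support is closed,
    \<open>sqrt\<close> is continuous on the whole line, and heights 1 and -1 give the poles, so
    \<open>V\<close> is an open neighbourhood of both.\<close>
  define V where "V = meridian s -` (- vf_support s Z)"
  have cm: "continuous_on UNIV (meridian s)"
    unfolding meridian_def by (intro continuous_intros)
  have "open V"
    unfolding V_def by (rule open_vimage[OF _ cm]) (simp add: vf_support_def open_Compl)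
  have "1 \<in> V" "-1 \<in> V"
    using supp by (auto simp: V_def meridian_def)
  have fV: "f z = 0" if "z \<in> V" for z
  proof (cases "\<bar>z\<bar> < 1")
    case True
    have "meridian s z \<notin> closure {p \<in> ellipsoid s. Z p \<noteq> 0}"
      using that by (simp add: V_def vf_support_def)
    then have "meridian s z \<notin> {p \<in> ellipsoid s. Z p \<noteq> 0}"
      using closure_subset[of "{p \<in> ellipsoid s. Z p \<noteq> 0}"] by (meson subsetD)
    then have "Z (meridian s z) = 0" using meridian_in_ellipsoid True by auto
    moreover have "1 - z\<^sup>2 > 0" using True by (simp add: abs_square_less_1)
    ultimately show ?thesis
      using FZ[OF True] s by (simp add: f_def)
  qed (simp add: f_def)
  define B where "B = V \<union> {z. \<bar>z\<bar> > 1}"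
  have "open B"
    unfolding B_def using \<open>open V\<close> by (intro open_Un open_Collect_less continuous_intros)
  have fB: "f z = 0" if "z \<in> B" for z using that fV[of z] by (auto simp: B_def f_def)
  have zero: "C2_on B (\<lambda>z. 0) (\<lambda>z. 0) (\<lambda>z. 0)" by (simp add: C2_on_def)
  have CB: "C2_on B f (deriv f) (deriv (deriv f))"
    using C2_on_deriv[OF \<open>open B\<close> zero] fB by blast
  have X2: "ck_on 2 U X" using X by (simp add: smooth_on_def)
  have "meridian s z \<in> U" if "\<bar>z\<bar> < 1" for z using U meridian_in_ellipsoid that
    by (meson less_imp_le subsetD)
  from meridian_C2[OF X2 this]
  obtain h' h'' where h: "C2_on {-1<..<1} (\<lambda>z. X (meridian s z) $ 2) h' h''" by blast
  \<comment> \<open>The factor by which the second component of the field must be multiplied,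
    besides 1/s, to give the profile.\<close>
  define \<rho> where "\<rho> z = inverse (sqrt (1 - z\<^sup>2))" for z :: real
  have \<rho>: "C2_on {-1<..<1} \<rho> (\<lambda>z. z * \<rho> z ^ 3) (\<lambda>z. \<rho> z ^ 3 + 3 * z\<^sup>2 * \<rho> z ^ 5)"
    unfolding C2_on_def
  proof (intro ballI conjI)
    fix z :: real assume "z \<in> {-1<..<1}"
    then have "\<bar>z\<bar> < 1" by auto
    then have z2: "z\<^sup>2 < 1" by (simp add: abs_square_less_1)
    define r where "r = sqrt (1 - z\<^sup>2)"
    have r: "r > 0" "r\<^sup>2 = 1 - z\<^sup>2" using z2 by (simp_all add: r_def)
    have "(\<rho> has_real_derivative - (inverse r * (inverse r / 2 * (- (2 * z))) * inverse r)) (at z)"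
      unfolding \<rho>_def r_def using z2 by (auto intro!: derivative_eq_intros)
    moreover have "- (inverse r * (inverse r / 2 * (- (2 * z))) * inverse r) = z * \<rho> z ^ 3"
      unfolding \<rho>_def r_def[symmetric] using r(1) by (simp add: divide_simps power3_eq_cube)
    ultimately show d: "(\<rho> has_real_derivative z * \<rho> z ^ 3) (at z)" by metis
    show "((\<lambda>z. z * \<rho> z ^ 3) has_real_derivative \<rho> z ^ 3 + 3 * z\<^sup>2 * \<rho> z ^ 5) (at z)"
      using DERIV_mult[OF DERIV_ident DERIV_power[OF d, of 3]]
      by (rule DERIV_cong) (simp add: power2_eq_square eval_nat_numeral algebra_simps)
    show "isCont (\<lambda>z. \<rho> z ^ 3 + 3 * z\<^sup>2 * \<rho> z ^ 5) z"
      by (intro continuous_intros DERIV_isCont[OF d])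
  qed
  have const: "C2_on {-1<..<1} (\<lambda>z. inverse s) (\<lambda>z. 0) (\<lambda>z. 0)" by (simp add: C2_on_def)
  have "f z = X (meridian s z) $ 2 * (\<rho> z * inverse s)" if "z \<in> {-1<..<1}" for z
  proof -
    from that have z: "\<bar>z\<bar> < 1" by auto
    define r where "r = sqrt (1 - z\<^sup>2)"
    have "1 - z\<^sup>2 > 0" using z by (simp add: abs_square_less_1)
    then have "r \<noteq> 0" by (simp add: r_def)
    moreover have "X (meridian s z) $ 2 = F z * (s * r)"
      using XZ[OF meridian_in_ellipsoid, of z] FZ[OF z] z by (simp add: r_def)
    ultimately show ?thesis
      using z s unfolding f_def \<rho>_def r_def[symmetric] by (simp add: field_simps)
  qed
  from C2_on_deriv[OF _ C2_on_mult[OF h C2_on_mult[OF \<rho> const]] this]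
  have "C2_on {-1<..<1} f (deriv f) (deriv (deriv f))" by simp
  moreover have "z \<in> {-1<..<1} \<or> z \<in> B" for z
    using \<open>1 \<in> V\<close> \<open>-1 \<in> V\<close> by (cases "z = 1 \<or> z = -1") (auto simp: B_def)
  ultimately show "C2_on UNIV f (deriv f) (deriv (deriv f))"
    using CB unfolding C2_on_def by blast
  show "Z p = zonal_ext f p" if p: "p \<in> ellipsoid s" for p
  proof (cases "\<bar>p$3\<bar> < 1")
    case True
    then show ?thesis using Zp[OF p] by (simp add: zonal_ext_def f_def)
  next
    case False
    \<comment> \<open>Here p is a pole, where the rotation field vanishes, so the default value of
      \<open>f\<close> agrees with Z.\<close>
    then have "1 - (p$3)\<^sup>2 \<le> 0" by (simp add: abs_square_less_1[symmetric] not_less)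
    then have "(p$1)\<^sup>2 + (p$2)\<^sup>2 \<le> 0"
      using p by (simp add: ellipsoid_def mult_nonneg_nonpos)
    then have "p$1 = 0" "p$2 = 0" by (simp_all add: sum_power2_le_zero_iff)
    then show ?thesis using Zp[OF p] by (simp add: zonal_ext_def vec_eq_iff forall_3)
  qed
qed

section \<open>Integration over the surface\<close>

text \<open>By Fubini: over a full circle the squares of sine and cosine each integrate to pi, and
  the cosine integrates to 0.\<close>

lemma trig_box_integral:
  fixes A B C :: "real \<Rightarrow> real"
  assumes cont: "continuous_on UNIV A" "continuous_on UNIV B" "continuous_on UNIV C"
    and h: "\<And>\<theta> \<phi>. h (\<theta>, \<phi>) = A \<phi> * (cos \<theta>)\<^sup>2 + B \<phi> * (sin \<theta>)\<^sup>2 + C \<phi> * cos \<theta>"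
  shows "set_lebesgue_integral lborel (box (0, -pi/2) (2*pi, pi/2)) h =
     pi * integral {-pi/2..pi/2} (\<lambda>\<phi>. A \<phi> + B \<phi>)"
proof -
  have h': "h = (\<lambda>q. A (snd q) * (cos (fst q))\<^sup>2 + B (snd q) * (sin (fst q))\<^sup>2 + C (snd q) * cos (fst q))"
    by (auto simp: fun_eq_iff h)
  have c: "continuous_on S (\<lambda>q::real\<times>real. A (snd q))" "continuous_on S (\<lambda>q::real\<times>real. B (snd q))"
    "continuous_on S (\<lambda>q::real\<times>real. C (snd q))" for S
    by (rule continuous_on_compose2[OF cont(1)] continuous_on_compose2[OF cont(2)]
        continuous_on_compose2[OF cont(3)]; auto intro: continuous_intros)+
  have ch: "continuous_on S h" for S
    unfolding h' by (intro continuous_intros c)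
  \<comment> \<open>Continuity on the closed box gives integrability there. Passing to the open box
    does not change the integral.\<close>
  have "set_integrable lborel (cbox (0, -pi/2) (2*pi, pi/2)) h"
    unfolding set_integrable_def by (intro borel_integrable_compact compact_cbox ch)
  then have "set_integrable lborel (box (0, -pi/2) (2*pi, pi/2)) h"
    by (rule set_integrable_subset) (auto simp: box_subset_cbox)
  then have "set_lebesgue_integral lborel (box (0, -pi/2) (2*pi, pi/2)) h
      = integral (cbox (0, -pi/2) (2*pi, pi/2)) h"
    by (simp add: set_borel_integral_eq_integral(2) integral_open_interval)
  also have "\<dots> = integral {0..2*pi} (\<lambda>\<theta>. integral {-pi/2..pi/2} (\<lambda>\<phi>. h (\<theta>, \<phi>)))"
    by (simp add: integral_prod_continuous[OF ch])
  also have "\<dots> = integral {0..2*pi} (\<lambda>\<theta>. integral {-pi/2..pi/2} A * (cos \<theta>)\<^sup>2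
      + integral {-pi/2..pi/2} B * (sin \<theta>)\<^sup>2 + integral {-pi/2..pi/2} C * cos \<theta>)"
  proof (rule integral_cong)
    fix \<theta>
    have "A integrable_on {-pi/2..pi/2}" "B integrable_on {-pi/2..pi/2}" "C integrable_on {-pi/2..pi/2}"
      using cont by (auto intro!: integrable_continuous_interval intro: continuous_on_subset)
    then show "integral {-pi/2..pi/2} (\<lambda>\<phi>. h (\<theta>, \<phi>)) = integral {-pi/2..pi/2} A * (cos \<theta>)\<^sup>2
      + integral {-pi/2..pi/2} B * (sin \<theta>)\<^sup>2 + integral {-pi/2..pi/2} C * cos \<theta>"
      unfolding h
      by (intro integral_unique has_integral_add has_integral_mult_left integrable_integral)
  qed
  also have "\<dots> = pi * (integral {-pi/2..pi/2} A + integral {-pi/2..pi/2} B)"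
  proof -
    define a b c where "a = integral {-pi/2..pi/2} A" "b = integral {-pi/2..pi/2} B" "c = integral {-pi/2..pi/2} C"
    let ?P = "\<lambda>\<theta>::real. a * (\<theta> + sin \<theta> * cos \<theta>) / 2 + b * (\<theta> - sin \<theta> * cos \<theta>) / 2 + c * sin \<theta>"
    have "((\<lambda>\<theta>. a * (cos \<theta>)\<^sup>2 + b * (sin \<theta>)\<^sup>2 + c * cos \<theta>) has_integral ?P (2*pi) - ?P 0) {0..2*pi}"
    proof (rule fundamental_theorem_of_calculus)
      fix t :: real
      \<comment> \<open>Replacing each constant 1 by this sum turns the double-angle expressions
        into squares.\<close>
      have 1: "1 = (sin t)\<^sup>2 + (cos t)\<^sup>2" by simp
      have "(?P has_real_derivative a * (1 + (cos t * cos t - sin t * sin t)) / 2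
         + b * (1 - (cos t * cos t - sin t * sin t)) / 2 + c * cos t) (at t within {0..2*pi})"
        by (auto intro!: derivative_eq_intros)
      moreover have "a * (1 + (cos t * cos t - sin t * sin t)) / 2
         + b * (1 - (cos t * cos t - sin t * sin t)) / 2 + c * cos t
         = a * (cos t)\<^sup>2 + b * (sin t)\<^sup>2 + c * cos t"
        by (subst (1 2) 1) (simp add: power2_eq_square)
      ultimately show "(?P has_vector_derivative a * (cos t)\<^sup>2 + b * (sin t)\<^sup>2 + c * cos t) (at t within {0..2*pi})"
        by (simp add: has_real_derivative_iff_has_vector_derivative)
    qed simp
    then show ?thesis
      by (intro integral_unique) (simp add: a_b_c_def algebra_simps)
  qed
  also have "integral {-pi/2..pi/2} A + integral {-pi/2..pi/2} B = integral {-pi/2..pi/2} (\<lambda>\<phi>. A \<phi> + B \<phi>)"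
    using cont by (intro Henstock_Kurzweil_Integration.integral_add[symmetric] integrable_continuous_interval)
       (auto intro: continuous_on_subset)
  finally show ?thesis .
qed

section \<open>The area element in the chart\<close>

lemma chart_has_derivative:
  "(chart s has_derivative (\<lambda>(h, k). vector
      [- s * sin \<phi> * cos \<theta> * k - s * cos \<phi> * sin \<theta> * h,
       - s * sin \<phi> * sin \<theta> * k + s * cos \<phi> * cos \<theta> * h, cos \<phi> * k])) (at (\<theta>, \<phi>))"
proof -
  have *: "chart s = (\<lambda>q. vector [s * cos (snd q) * cos (fst q), s * cos (snd q) * sin (fst q), sin (snd q)])"
    by (auto simp: chart_def fun_eq_iff)
  show ?thesis
    unfolding *
    by (auto intro!: derivative_eq_intros has_derivative_vector_3 simp: fun_eq_iff vec_eq_iff forall_3 algebra_simps)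
qed

lemma chart_in_ellipsoid: "chart s q \<in> ellipsoid s"
proof -
  have "(s * cos \<phi> * cos \<theta>)\<^sup>2 + (s * cos \<phi> * sin \<theta>)\<^sup>2 = s\<^sup>2 * (cos \<phi>)\<^sup>2 * ((sin \<theta>)\<^sup>2 + (cos \<theta>)\<^sup>2)" for \<theta> \<phi>
    by algebra
  then show ?thesis
    by (cases q) (simp add: chart_def ellipsoid_def cos_squared_eq)
qed

context
  fixes s :: real
  assumes s: "s > 1"
begin

text \<open>With z = sin \<phi> this is the form d\<theta> \<and> dz divided by
  \<open>recip_norm s z\<close>, as dz = cos \<phi> d\<phi>.\<close>

lemma volume_form_chart:
  "volume_form s (chart s (\<theta>, \<phi>))
     (frechet_derivative (chart s) (at (\<theta>, \<phi>)) (1, 0))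
     (frechet_derivative (chart s) (at (\<theta>, \<phi>)) (0, 1)) = cos \<phi> / recip_norm s (sin \<phi>)"
proof -
  let ?g = "recip_norm s (sin \<phi>)"
  have D: "frechet_derivative (chart s) (at (\<theta>, \<phi>)) = (\<lambda>(h, k). vector
      [- s * sin \<phi> * cos \<theta> * k - s * cos \<phi> * sin \<theta> * h,
       - s * sin \<phi> * sin \<theta> * k + s * cos \<phi> * cos \<theta> * h, cos \<phi> * k])"
    by (rule frechet_derivative_at[OF chart_has_derivative, symmetric])
  have z: "chart s (\<theta>, \<phi>) $ 3 = sin \<phi>" by (simp add: chart_def)
  have "volume_form s (chart s (\<theta>, \<phi>))
     (frechet_derivative (chart s) (at (\<theta>, \<phi>)) (1, 0))
     (frechet_derivative (chart s) (at (\<theta>, \<phi>)) (0, 1))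
    = ?g * s\<^sup>2 * cos \<phi> * ((cos \<phi>)\<^sup>2 * ((sin \<theta>)\<^sup>2 + (cos \<theta>)\<^sup>2) + s\<^sup>2 * (sin \<phi>)\<^sup>2 * ((sin \<theta>)\<^sup>2 + (cos \<theta>)\<^sup>2))"
    unfolding volume_form_def D sgn_conormal[OF s chart_in_ellipsoid] z
    \<comment> \<open>The sums of squares stay unsimplified, so that both sides agree as polynomials
      in sines and cosines.\<close>
    by (simp add: inner_3 cross3_def conormal_def chart_def del: sin_cos_squared_add sin_cos_squared_add2) algebra
  also have "\<dots> = ?g * s\<^sup>2 * cos \<phi> * (1 + (s\<^sup>2 - 1) * (sin \<phi>)\<^sup>2)"
    by (simp add: cos_squared_eq algebra_simps)
  also have "\<dots> = cos \<phi> * (?g\<^sup>2 * (s\<^sup>2 * (1 + (s\<^sup>2 - 1) * (sin \<phi>)\<^sup>2))) / ?g"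
    using recip_norm_gt_0[OF s, of "sin \<phi>"] by (simp add: power2_eq_square)
  also have "\<dots> = cos \<phi> / ?g"
    by (simp only: recip_norm_sq[OF s] mult_1_right)
  finally show ?thesis .
qed

lemma surface_integral_trig:
  fixes A B C :: "real \<Rightarrow> real"
  assumes cont: "continuous_on UNIV A" "continuous_on UNIV B" "continuous_on UNIV C"
    and h: "\<And>\<theta> \<phi>. h (chart s (\<theta>, \<phi>)) * (cos \<phi> / recip_norm s (sin \<phi>))
       = A \<phi> * (cos \<theta>)\<^sup>2 + B \<phi> * (sin \<theta>)\<^sup>2 + C \<phi> * cos \<theta>"
  shows "surface_integral s h = pi * integral {-pi/2..pi/2} (\<lambda>\<phi>. A \<phi> + B \<phi>)"
  unfolding surface_integral_def
  by (rule trig_box_integral[OF cont]) (simp only: volume_form_chart h)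

end

section \<open>The curvature\<close>

context
  fixes s :: real
  assumes s: "s > 1"
begin

text \<open>The stream field is e2 \<times> n with n the unit normal. The triple product n \<bullet>
  (v \<times> (e2 \<times> n)) equals (n \<bullet> e2)(v \<bullet> n) - v \<bullet> e2, and v
  \<bullet> n = 0.\<close>

lemma volume_form_stream_field:
  assumes p: "p \<in> ellipsoid s" and v: "v \<in> tangent_plane s p"
  shows "volume_form s p v (stream_field s p) = - v$2"
proof -
  let ?g = "recip_norm s (p$3)"
  have pe: "(p$1)\<^sup>2 + (p$2)\<^sup>2 = s\<^sup>2 * (1 - (p$3)\<^sup>2)" using p by (simp add: ellipsoid_def)
  have v': "v$1 * p$1 + s\<^sup>2 * (v$3 * p$3) = - (v$2 * p$2)"
    using v by (simp add: tangent_plane_iff)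
  have "volume_form s p v (stream_field s p) = ?g\<^sup>2 * (p$2 * (v$1 * p$1 + s\<^sup>2 * (v$3 * p$3))
      - v$2 * ((p$1)\<^sup>2 + s\<^sup>2 * s\<^sup>2 * (p$3)\<^sup>2))"
    unfolding volume_form_def sgn_conormal[OF s p]
    by (simp add: inner_3 cross3_def conormal_def stream_field_def) algebra
  also have "\<dots> = - v$2 * (?g\<^sup>2 * (((p$1)\<^sup>2 + (p$2)\<^sup>2) + s\<^sup>2 * s\<^sup>2 * (p$3)\<^sup>2))"
    unfolding v' by algebra
  also have "((p$1)\<^sup>2 + (p$2)\<^sup>2) + s\<^sup>2 * s\<^sup>2 * (p$3)\<^sup>2 = s\<^sup>2 * (1 + (s\<^sup>2 - 1) * (p$3)\<^sup>2)"
    unfolding pe by algebra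
  finally show ?thesis using recip_norm_sq[OF s, of "p$3"] by simp
qed

text \<open>\<open>P\<close> is the integrand of the overview after the substitution z = sin \<phi>.
  The bracket ignores central components, so b does not enter. Continuity of \<open>P\<close> serves
  the strict inequality later.\<close>

lemma misiolek_curvature_zonal:
  fixes a b :: real
  assumes f: "C2_on UNIV f f' f''"
    and Z: "\<And>p. p \<in> ellipsoid s \<Longrightarrow> Z p = zonal_ext f p"
  defines "P \<equiv> (\<lambda>\<phi>. s\<^sup>2 * cos \<phi> ^ 3 *
     (s\<^sup>2 * (cos \<phi>)\<^sup>2 * (s\<^sup>2 - 1) * recip_norm s (sin \<phi>) ^ 3 * (f (sin \<phi>))\<^sup>2 - a * f (sin \<phi>)))"
  shows "misiolek_curvature (ext_bracket s) (ext_inner s) (Z, a) (stream_field s, b)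
     = pi * integral {-pi/2..pi/2} P" and "continuous_on UNIV P"
proof -
  let ?Y = "stream_field s" and ?g = "recip_norm s" and ?G = "recip_norm' s"
  let ?I = "integral {-pi/2..pi/2}"
  define W where "W = vf_bracket s Z ?Y"
  have df: "\<And>z. (f has_real_derivative f' z) (at z)" "\<And>z. (f' has_real_derivative f'' z) (at z)"
    and cf2: "\<And>z. isCont f'' z"
    using f by (auto simp: C2_on_def)
  have W: "W p = zonal_bracket s f f' p" if "p \<in> ellipsoid s" for p
    unfolding W_def by (rule vf_bracket_zonal[OF s df(1) Z that])
  have g0: "?g z \<noteq> 0" for z using recip_norm_gt_0[OF s, of z] by simp
  have csin: "continuous_on UNIV (\<lambda>\<phi>. h (sin \<phi>))" if "\<And>z. isCont h z" for h :: "real \<Rightarrow> real"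
    by (rule continuous_on_compose2[of UNIV h]) (auto intro!: continuous_at_imp_continuous_on that continuous_intros)
  have Gcont: "isCont ?G z" for z
    unfolding recip_norm'_def by (intro continuous_intros DERIV_isCont[OF recip_norm_deriv[OF s]])
  note cont = csin[OF DERIV_isCont[OF df(1)]] csin[OF DERIV_isCont[OF df(2)]] csin[OF cf2]
    csin[OF DERIV_isCont[OF recip_norm_deriv[OF s]]] csin[OF Gcont]
  show contP: "continuous_on UNIV P"
    unfolding P_def by (intro continuous_intros cont)

  \<comment> \<open>\<open>A\<close> and \<open>B\<close> are the coefficients of cos^2 \<theta> and
    sin^2 \<theta>, area element included. Indices 1, 2, 3 belong to the square of W, to the pairing
    of Z with the bracket of W and the stream field, and to the cocycle of W. \<open>C4\<close> is
    the coefficient of cos \<theta> in the cocycle of Z.\<close>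
  define A1 where "A1 \<phi> = cos \<phi> * ?g (sin \<phi>) * (s\<^sup>2 * (f' (sin \<phi>) * (cos \<phi>)\<^sup>2 - f (sin \<phi>) * sin \<phi>))\<^sup>2" for \<phi>
  define B1 where "B1 \<phi> = cos \<phi> * ?g (sin \<phi>) * (s * f (sin \<phi>))\<^sup>2 * (s\<^sup>2 * (sin \<phi>)\<^sup>2 + (cos \<phi>)\<^sup>2)" for \<phi>
  define A2 where "A2 \<phi> = cos \<phi> ^ 3 * s ^ 4 * f (sin \<phi>) *
      ((?G (sin \<phi>) * f' (sin \<phi>) + ?g (sin \<phi>) * f'' (sin \<phi>)) * (cos \<phi>)\<^sup>2
       - (2 * ?g (sin \<phi>) * f' (sin \<phi>) * sin \<phi>
          + (?G (sin \<phi>) * f (sin \<phi>) + ?g (sin \<phi>) * f' (sin \<phi>)) * sin \<phi> + ?g (sin \<phi>) * f (sin \<phi>)))" for \<phi>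
  define B2 where "B2 \<phi> = - (cos \<phi> ^ 3) * s ^ 4 * f (sin \<phi>) *
      (f (sin \<phi>) * (?G (sin \<phi>) * sin \<phi> + ?g (sin \<phi>)) + ?g (sin \<phi>) * f' (sin \<phi>) * sin \<phi>)" for \<phi>
  define A3 where "A3 \<phi> = - s\<^sup>2 * sin \<phi> * cos \<phi> * (f' (sin \<phi>) * (cos \<phi>)\<^sup>2 - f (sin \<phi>) * sin \<phi>)" for \<phi>
  define B3 where "B3 \<phi> = s\<^sup>2 * cos \<phi> * (sin \<phi>)\<^sup>2 * f (sin \<phi>)" for \<phi>
  define C4 where "C4 \<phi> = - s * sin \<phi> * (cos \<phi>)\<^sup>2 * f (sin \<phi>) / ?g (sin \<phi>)" for \<phi>
  have cA: "continuous_on UNIV A1" "continuous_on UNIV B1" "continuous_on UNIV A2" "continuous_on UNIV B2"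
    "continuous_on UNIV A3" "continuous_on UNIV B3" "continuous_on UNIV C4"
    unfolding A1_def[abs_def] B1_def[abs_def] A2_def[abs_def] B2_def[abs_def] A3_def[abs_def] B3_def[abs_def] C4_def[abs_def]
    by (intro continuous_intros cont; simp add: g0)+
  have c0: "continuous_on UNIV (\<lambda>\<phi>::real. 0::real)" by simp

  have chart: "chart s (\<theta>, \<phi>) $ 1 = s * cos \<phi> * cos \<theta>" "chart s (\<theta>, \<phi>) $ 2 = s * cos \<phi> * sin \<theta>"
    "chart s (\<theta>, \<phi>) $ 3 = sin \<phi>" for \<theta> \<phi>
    by (simp_all add: chart_def)

  have S1: "vf_inner s W W = pi * ?I (\<lambda>\<phi>. A1 \<phi> + B1 \<phi>)"
    unfolding vf_inner_def
  proof (rule surface_integral_trig[OF s cA(1) cA(2) c0])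
    fix \<theta> \<phi> :: real
    define g h h' S K where gs: "g = ?g (sin \<phi>)" "h = f (sin \<phi>)" "h' = f' (sin \<phi>)" "S = sin \<theta>" "K = cos \<theta>"
    have SK: "S\<^sup>2 + K\<^sup>2 = 1" by (simp add: gs)
    have "g \<noteq> 0" using g0 by (simp add: gs)
    have "W (chart s (\<theta>, \<phi>)) \<bullet> W (chart s (\<theta>, \<phi>)) = g\<^sup>2 * ((h' * (s * cos \<phi> * K) * (s * cos \<phi> * S))\<^sup>2
       + (h' * (s * cos \<phi> * K)\<^sup>2 - s\<^sup>2 * h * sin \<phi>)\<^sup>2 + (h * (s * cos \<phi> * S))\<^sup>2)"
      unfolding W[OF chart_in_ellipsoid] zonal_bracket_def
      by (simp add: inner_3 chart gs power2_eq_square algebra_simps)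
    \<comment> \<open>The relation \<open>SK\<close> lowers the quartic terms to quadratic ones and
      splits the term free of \<theta> between \<open>K\<close> and \<open>S\<close>.\<close>
    also have "\<dots> = g\<^sup>2 * ((s\<^sup>2 * (h' * (cos \<phi>)\<^sup>2 - h * sin \<phi>))\<^sup>2 * K\<^sup>2
       + (s * h)\<^sup>2 * (s\<^sup>2 * (sin \<phi>)\<^sup>2 + (cos \<phi>)\<^sup>2) * S\<^sup>2)"
      using SK by algebra
    finally have eq: "W (chart s (\<theta>, \<phi>)) \<bullet> W (chart s (\<theta>, \<phi>)) = \<dots>" .
    show "W (chart s (\<theta>, \<phi>)) \<bullet> W (chart s (\<theta>, \<phi>)) * (cos \<phi> / ?g (sin \<phi>)) =
       A1 \<phi> * (cos \<theta>)\<^sup>2 + B1 \<phi> * (sin \<theta>)\<^sup>2 + 0 * cos \<theta>"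
      unfolding eq A1_def B1_def gs[symmetric] using \<open>g \<noteq> 0\<close> by (simp add: divide_simps) algebra
  qed

  have S2: "vf_inner s Z (vf_bracket s W ?Y) = pi * ?I (\<lambda>\<phi>. A2 \<phi> + B2 \<phi>)"
    unfolding vf_inner_def
  proof (rule surface_integral_trig[OF s cA(3) cA(4) c0])
    fix \<theta> \<phi> :: real
    have eq: "zonal_ext f (chart s (\<theta>, \<phi>)) \<bullet> vf_bracket s W ?Y (chart s (\<theta>, \<phi>)) =
      f (sin \<phi>) * ?g (sin \<phi>) * ((?G (sin \<phi>) * f' (sin \<phi>) + ?g (sin \<phi>) * f'' (sin \<phi>)) * (s * cos \<phi> * cos \<theta>)\<^sup>2 * (s\<^sup>2 * (cos \<phi>)\<^sup>2)
       - s\<^sup>2 * (s * cos \<phi> * sin \<theta>)\<^sup>2 * (f (sin \<phi>) * (?G (sin \<phi>) * sin \<phi> + ?g (sin \<phi>)) + ?g (sin \<phi>) * f' (sin \<phi>) * sin \<phi>)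
       - s\<^sup>2 * (s * cos \<phi> * cos \<theta>)\<^sup>2 * (2 * ?g (sin \<phi>) * f' (sin \<phi>) * sin \<phi>
           + (?G (sin \<phi>) * f (sin \<phi>) + ?g (sin \<phi>) * f' (sin \<phi>)) * sin \<phi> + ?g (sin \<phi>) * f (sin \<phi>)))"
      using zonal_inner_bracket_bracket[OF s df W chart_in_ellipsoid, of "(\<theta>, \<phi>)"]
      by (simp only: chart cos_squared_eq[symmetric])
    show "Z (chart s (\<theta>, \<phi>)) \<bullet> vf_bracket s W ?Y (chart s (\<theta>, \<phi>)) * (cos \<phi> / ?g (sin \<phi>)) =
       A2 \<phi> * (cos \<theta>)\<^sup>2 + B2 \<phi> * (sin \<theta>)\<^sup>2 + 0 * cos \<theta>"
      unfolding Z[OF chart_in_ellipsoid] eq A2_def B2_def using g0[of "sin \<phi>"]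
      by (simp add: divide_simps) algebra
  qed

  have S3: "cocycle s W ?Y = pi * ?I (\<lambda>\<phi>. A3 \<phi> + B3 \<phi>)"
    unfolding cocycle_def
  proof (rule surface_integral_trig[OF s cA(5) cA(6) c0])
    fix \<theta> \<phi> :: real
    let ?p = "chart s (\<theta>, \<phi>)"
    have SK: "(sin \<theta>)\<^sup>2 + (cos \<theta>)\<^sup>2 = 1" by simp
    \<comment> \<open>Only the second component of W survives, and its factor
      \<open>recip_norm\<close> cancels against the area element.\<close>
    have "volume_form s ?p (W ?p) (?Y ?p) = - (W ?p $ 2)"
      unfolding W[OF chart_in_ellipsoid]
      by (rule volume_form_stream_field[OF chart_in_ellipsoid zonal_bracket_tangent])
    then have "eta_form s ?p (W ?p) (?Y ?p) * (cos \<phi> / ?g (sin \<phi>))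
        = - sin \<phi> * cos \<phi> * (f' (sin \<phi>) * (s * cos \<phi> * cos \<theta>)\<^sup>2 - s\<^sup>2 * f (sin \<phi>) * sin \<phi>)"
      unfolding eta_form_def using g0[of "sin \<phi>"]
      by (simp add: W[OF chart_in_ellipsoid] zonal_bracket_def chart)
    also have "\<dots> = A3 \<phi> * (cos \<theta>)\<^sup>2 + B3 \<phi> * (sin \<theta>)\<^sup>2 + 0 * cos \<theta>"
      unfolding A3_def B3_def using SK by algebra
    finally show "eta_form s ?p (W ?p) (?Y ?p) * (cos \<phi> / ?g (sin \<phi>)) = \<dots>" .
  qed

  \<comment> \<open>The integrand is a multiple of cos \<theta>, so the integral is 0. This removes
    the central part of the bracket from its norm.\<close>
  have S4: "cocycle s Z ?Y = pi * ?I (\<lambda>\<phi>. 0 + 0)"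
    unfolding cocycle_def
  proof (rule surface_integral_trig[OF s c0 c0 cA(7)])
    fix \<theta> \<phi> :: real
    let ?p = "chart s (\<theta>, \<phi>)"
    have "volume_form s ?p (Z ?p) (?Y ?p) = - (Z ?p $ 2)"
      unfolding Z[OF chart_in_ellipsoid]
      by (rule volume_form_stream_field[OF chart_in_ellipsoid zonal_ext_tangent])
    then show "eta_form s ?p (Z ?p) (?Y ?p) * (cos \<phi> / ?g (sin \<phi>))
        = 0 * (cos \<theta>)\<^sup>2 + 0 * (sin \<theta>)\<^sup>2 + C4 \<phi> * cos \<theta>"
      unfolding eta_form_def C4_def
      by (simp add: Z[OF chart_in_ellipsoid] zonal_ext_def chart power2_eq_square mult_ac)
  qed

  \<comment> \<open>The curvature squares a \<open>sqrt\<close>, which gives back the inner product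
    only if that is nonnegative.\<close>
  have nonneg: "vf_inner s W W \<ge> 0"
  proof -
    have "?I (\<lambda>\<phi>. A1 \<phi> + B1 \<phi>) \<ge> 0"
    proof (rule Henstock_Kurzweil_Integration.integral_nonneg)
      show "(\<lambda>\<phi>. A1 \<phi> + B1 \<phi>) integrable_on {-pi/2..pi/2}"
        by (rule integrable_continuous_interval, rule continuous_on_subset[of UNIV])
          (auto intro!: continuous_on_add cA)
      fix \<phi> :: real assume "\<phi> \<in> {-pi/2..pi/2}"
      then have "cos \<phi> \<ge> 0" by (intro cos_ge_zero) auto
      then show "A1 \<phi> + B1 \<phi> \<ge> 0"
        using recip_norm_gt_0[OF s, of "sin \<phi>"] unfolding A1_def B1_def
        by (intro add_nonneg_nonneg mult_nonneg_nonneg) auto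
    qed
    then show ?thesis by (simp add: S1)
  qed

  text \<open>A primitive, in the variable \<open>z = sin \<phi>\<close>, of the terms that integration by parts removes;
    it vanishes at the poles.\<close>
  define c2 where "c2 z = s\<^sup>2 * (1 - z\<^sup>2)" for z
  define H where "H z = c2 z * (- (f z * ?g z * f' z * c2 z) + ?g z * s\<^sup>2 * z * (f z)\<^sup>2 + a * f z * z)" for z
  define H' where "H' z = - (2 * s\<^sup>2 * z) * (- (f z * ?g z * f' z * c2 z) + ?g z * s\<^sup>2 * z * (f z)\<^sup>2 + a * f z * z)
     + c2 z * (- (f' z * ?g z * f' z * c2 z + f z * ?G z * f' z * c2 z + f z * ?g z * f'' z * c2 z
            - f z * ?g z * f' z * (2 * s\<^sup>2 * z))
        + ?G z * s\<^sup>2 * z * (f z)\<^sup>2 + ?g z * s\<^sup>2 * (f z)\<^sup>2 + ?g z * s\<^sup>2 * z * (2 * f z * f' z)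
        + a * f' z * z + a * f z)" for z
  have dH: "(H has_real_derivative H' z) (at z)" for z
    unfolding H_def c2_def
    by (rule derivative_eq_intros df recip_norm_deriv[OF s] refl)+
      (simp add: H'_def c2_def algebra_simps power2_eq_square)

  \<comment> \<open>Integration by parts in pointwise form: the integrand is \<open>P\<close> plus
    the derivative of \<open>H\<close> composed with sine.\<close>
  have key: "- (A1 \<phi> + B1 \<phi>) - (A2 \<phi> + B2 \<phi>) - a * (A3 \<phi> + B3 \<phi>) = P \<phi> + H' (sin \<phi>) * cos \<phi>" for \<phi>
  proof -
    define z k g G h h' h'' where d: "z = sin \<phi>" "k = cos \<phi>" "g = ?g z" "G = ?G z" "h = f z" "h' = f' z" "h'' = f'' z"
    have k2: "k\<^sup>2 = 1 - z\<^sup>2" by (simp add: d cos_squared_eq)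
    have G: "G = - (s\<^sup>2 - 1) * s\<^sup>2 * z * g ^ 3" by (simp add: d recip_norm'_def)
    have g: "g\<^sup>2 * (s\<^sup>2 * (1 + (s\<^sup>2 - 1) * z\<^sup>2)) = 1"
      unfolding d by (rule recip_norm_sq[OF s])
    have c2: "c2 z = s\<^sup>2 * k\<^sup>2" by (simp add: c2_def k2)
    \<comment> \<open>The full coefficient of f^2, one part coming from the derivative of
      \<open>recip_norm\<close>. The relation for g collapses it to a single term, which is
      nonnegative for s > 1.\<close>
    have Gg: "(s\<^sup>2 - 1) * g + G * z * s\<^sup>2 = (s\<^sup>2 - 1) * s\<^sup>2 * k\<^sup>2 * g ^ 3"
      unfolding G k2 using g by algebra
    have "- (A1 \<phi> + B1 \<phi>) - (A2 \<phi> + B2 \<phi>) - a * (A3 \<phi> + B3 \<phi>) - H' (sin \<phi>) * cos \<phi>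
        = k * (s\<^sup>2 * k\<^sup>2) * (h\<^sup>2 * ((s\<^sup>2 - 1) * g + G * z * s\<^sup>2) - a * h)"
      unfolding A1_def B1_def A2_def B2_def A3_def B3_def H'_def d[symmetric] c2
      by algebra
    also have "\<dots> = P \<phi>"
      unfolding Gg by (simp add: P_def d power2_eq_square power3_eq_cube algebra_simps)
    finally show ?thesis by simp
  qed

  have int: "(h has_integral ?I h) {-pi/2..pi/2}" if "continuous_on UNIV h" for h :: "real \<Rightarrow> real"
    by (intro integrable_integral integrable_continuous_interval continuous_on_subset[OF that]) simp
  have "((\<lambda>\<phi>. H' (sin \<phi>) * cos \<phi>) has_integral H (sin (pi/2)) - H (sin (-pi/2))) {-pi/2..pi/2}"
    by (rule fundamental_theorem_of_calculus)
       (auto intro!: DERIV_chain2[OF dH DERIV_sin] has_field_derivative_at_within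
         simp flip: has_real_derivative_iff_has_vector_derivative)
  then have "((\<lambda>\<phi>. H' (sin \<phi>) * cos \<phi>) has_integral 0) {-pi/2..pi/2}"
    by (simp add: H_def c2_def)
  from has_integral_add[OF int[OF contP] this]
  have 1: "((\<lambda>\<phi>. P \<phi> + H' (sin \<phi>) * cos \<phi>) has_integral ?I P) {-pi/2..pi/2}"
    by simp
  have 2: "((\<lambda>\<phi>. P \<phi> + H' (sin \<phi>) * cos \<phi>) has_integral
     - ?I (\<lambda>\<phi>. A1 \<phi> + B1 \<phi>) - ?I (\<lambda>\<phi>. A2 \<phi> + B2 \<phi>) - a * ?I (\<lambda>\<phi>. A3 \<phi> + B3 \<phi>)) {-pi/2..pi/2}"
    unfolding key[symmetric]
    by (intro has_integral_diff has_integral_neg has_integral_mult_right int continuous_on_add cA)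
  note I = has_integral_unique[OF 1 2]

  have "misiolek_curvature (ext_bracket s) (ext_inner s) (Z, a) (?Y, b)
      = - vf_inner s W W - (vf_inner s Z (vf_bracket s W ?Y) + a * cocycle s W ?Y)"
    using nonneg S4 by (simp add: misiolek_curvature_def ext_bracket_def ext_inner_def W_def)
  also have "\<dots> = pi * ?I P"
    unfolding S1 S2 S3 I by (simp add: algebra_simps)
  finally show "misiolek_curvature (ext_bracket s) (ext_inner s) (Z, a) (?Y, b) = pi * ?I P" .
qed

end

section \<open>Strict positivity of the curvature\<close>

theorem corollary1p3:
  fixes s a :: real and F :: "real \<Rightarrow> real" and Z :: "real^3 \<Rightarrow> real^3"
  assumes "s > 1"
    and "zonal_flow s F Z"
    and "west_facing F"
    and "\<exists>p\<in>ellipsoid s. Z p \<noteq> 0"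
    and "vf_support s Z \<subseteq> ellipsoid s - {vector [0, 0, 1], vector [0, 0, -1]}"
    and "a > 0"
  shows "\<exists>Y\<in>div_free_fields s. \<forall>b::real.
           misiolek_curvature (ext_bracket s) (ext_inner s) (Z, a) (Y, b) > 0"
proof (intro bexI allI)
  show "stream_field s \<in> div_free_fields s"
    by (rule stream_field_in) fact
  fix b
  have s: "s > 1" "s > 0" using assms by auto
  define f where "f z = (if \<bar>z\<bar> < 1 then F z else 0)" for z
  have f: "C2_on UNIV f (deriv f) (deriv (deriv f))"
    and Z: "\<And>p. p \<in> ellipsoid s \<Longrightarrow> Z p = zonal_ext f p"
    using zonal_profile_C2[OF s(2) assms(2,5)] unfolding f_def[abs_def] by blast+
  have f_le: "f z \<le> 0" for z
    using assms(3) by (auto simp: f_def west_facing_def abs_less_iff)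
  define P where "P = (\<lambda>\<phi>. s\<^sup>2 * cos \<phi> ^ 3 *
     (s\<^sup>2 * (cos \<phi>)\<^sup>2 * (s\<^sup>2 - 1) * recip_norm s (sin \<phi>) ^ 3 * (f (sin \<phi>))\<^sup>2 - a * f (sin \<phi>)))"
  have MC: "misiolek_curvature (ext_bracket s) (ext_inner s) (Z, a) (stream_field s, b)
     = pi * integral {-pi/2..pi/2} P"
    and contP: "continuous_on UNIV P"
    unfolding P_def by (rule misiolek_curvature_zonal[OF s(1) f Z], assumption)+
  have nn: "s\<^sup>2 * (cos \<phi>)\<^sup>2 * (s\<^sup>2 - 1) * recip_norm s (sin \<phi>) ^ 3 * (f (sin \<phi>))\<^sup>2 \<ge> 0" for \<phi>
    using recip_norm_gt_0[OF s(1), of "sin \<phi>"] s by (intro mult_nonneg_nonneg) auto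
  have P_nonneg: "P \<phi> \<ge> 0" if "\<phi> \<in> {-pi/2..pi/2}" for \<phi>
  proof -
    have "cos \<phi> \<ge> 0" using that by (intro cos_ge_zero) auto
    moreover have "a * f (sin \<phi>) \<le> 0" using f_le \<open>a > 0\<close> by (simp add: mult_nonneg_nonpos)
    ultimately show ?thesis unfolding P_def using nn[of \<phi>] by (intro mult_nonneg_nonneg) auto
  qed
  obtain p where p: "p \<in> ellipsoid s" "Z p \<noteq> 0" using assms(4) by blast
  define \<phi> where "\<phi> = arcsin (p$3)"
  \<comment> \<open>Since \<open>f\<close> is 0 outside the open interval, a point with nonzero Z is
    no pole. Its reduced latitude therefore has positive cosine.\<close>
  have fp: "f (p$3) \<noteq> 0" using p Z[OF p(1)] by (auto simp: zonal_ext_def)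
  then have p3: "\<bar>p$3\<bar> < 1" by (auto simp: f_def split: if_splits)
  then have \<phi>: "- (pi/2) < \<phi>" "\<phi> < pi/2" "sin \<phi> = p$3"
    using arcsin_lt_bounded[of "p$3"] by (auto simp: \<phi>_def)
  have "cos \<phi> > 0" using \<phi> by (intro cos_gt_zero_pi) auto
  \<comment> \<open>Strictness comes from the cocycle term: a is positive and the westward profile
    is negative here.\<close>
  moreover have "a * f (sin \<phi>) < 0"
    using f_le[of "p$3"] fp \<open>a > 0\<close> \<phi>(3) by (simp add: mult_pos_neg)
  ultimately have "P \<phi> > 0"
    unfolding P_def using nn[of \<phi>] s by (intro mult_pos_pos) auto
  \<comment> \<open>A continuous nonnegative function with zero integral vanishes at every point of
    the interval.\<close>
  then have "integral {-pi/2..pi/2} P \<noteq> 0"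
    using integral_eq_0_iff[of "-pi/2" "pi/2" P] P_nonneg continuous_on_subset[OF contP] \<phi>
    by (auto simp: less_imp_le dest!: bspec[of _ _ \<phi>])
  moreover have "integral {-pi/2..pi/2} P \<ge> 0"
    using P_nonneg by (intro Henstock_Kurzweil_Integration.integral_nonneg
        integrable_continuous_interval continuous_on_subset[OF contP]) auto
  ultimately show "misiolek_curvature (ext_bracket s) (ext_inner s) (Z, a) (stream_field s, b) > 0"
    unfolding MC by simp
qed

end
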